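(* Let $K$ be an algebraically closed field, and let $k,t,n$ be positive integers satisfying $$2n\ge t(k-1)+2k,\qquad t\ge 2.$$ Let $V$ be an $n$-dimensional vector space over $K$. Then for any $t$-tuple $\varphi_1,\dots,\varphi_t$ of alternating bilinear forms on $V$ there exists a $k$-dimensional subspace of $V$ that is simultaneously isotropic for all of the forms $\varphi_1,\dots,\varphi_t$.
   Context: A subspace $U\subset V$ is isotropic for a bilinear form $\varphi$ if $\varphi(u,u')=0$ for all $u,u'\in U$. A bilinear form $\varphi$ is alternating if $\varphi(v,v)=0$ for all $v\in V$. *)

theory Defs
  imports Complex_Main "HOL-Computational_Algebra.Polynomial"
begin

definition bilinear_form ::
    "('k::field \<Rightarrow> 'v::ab_group_add \<Rightarrow> 'v) \<Rightarrow> ('v \<Rightarrow> 'v \<Rightarrow> 'k) \<Rightarrow> bool"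
  where "bilinear_form scale \<phi> \<longleftrightarrow>
    (\<forall>u. Vector_Spaces.linear scale (*) (\<lambda>v. \<phi> u v)) \<and>
    (\<forall>v. Vector_Spaces.linear scale (*) (\<lambda>u. \<phi> u v))"

definition alternating :: "('v \<Rightarrow> 'v \<Rightarrow> 'k::zero) \<Rightarrow> bool"
  where "alternating \<phi> \<longleftrightarrow> (\<forall>v. \<phi> v v = 0)"

definition isotropic :: "('v \<Rightarrow> 'v \<Rightarrow> 'k::zero) \<Rightarrow> 'v set \<Rightarrow> bool"
  where "isotropic \<phi> U \<longleftrightarrow> (\<forall>u\<in>U. \<forall>u'\<in>U. \<phi> u u' = 0)"

text \<open>
  The library's \<open>vector_space.dim\<close> is 0 on infinite-dimensional spaces, so having
  dimension \<open>n > 0\<close> entails being finite-dimensional.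
\<close>

lemma (in vector_space) finite_basis_of_dim_pos:
  assumes "dim S > 0"
  shows "\<exists>B. finite B \<and> independent B \<and> span B = span S \<and> card B = dim S"
proof -
  obtain B where "independent B" "span B = span S"
    using assms by (auto simp: dim_def split: if_splits)
  moreover from this have "dim S = card B" by (intro dim_eq_card)
  ultimately show ?thesis
    using assms card_ge_0_finite by auto
qed

end

theory Submission
  imports Defs "HOL-Computational_Algebra.Formal_Laurent_Series"
begin

text \<open>
  Work in coordinates, write \<open>n = k + m\<close>, and let \<open>U\<^sub>0\<close> be the span of the first \<open>k\<close> basis vectors.
  Explicit forms \<open>\<psi>\<^sub>1, \<dots>, \<psi>\<^sub>t\<close>, which only pair \<open>U\<^sub>0\<close> with its complement, are chosen such that the
  linearised isotropy equations at \<open>U\<^sub>0\<close> are surjective; this is where \<open>2 m \<ge> t (k - 1)\<close> and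
  \<open>t \<ge> 2\<close> enter. Hence \<open>U\<^sub>0\<close> lifts, coefficient by coefficient, to a subspace over
  \<open>K((s))\<close> that is isotropic for the pencils \<open>\<psi>\<^sub>i + s (\<phi>\<^sub>i - \<psi>\<^sub>i)\<close>. The evaluation
  \<open>K[s] \<rightarrow> K\<close> at \<open>s = 1\<close> extends to a \<open>K\<close>-valued place of \<open>K((s))\<close> because \<open>K\<close> is
  algebraically closed (Chevalley). A basis of the lifted subspace can be normalised over the
  valuation ring so that its image under the place stays independent, and this image spans the
  required subspace.
\<close>

subsection \<open>Linear systems and their perturbations over power series\<close>

text \<open>Induction on the rows. The new row cannot vanish on the common kernel of the old rows,
  since it would then be a combination of them. A kernel vector on which it is nonzero therefore
  corrects the last equation without disturbing the others.\<close>

lemma linear_system_solvable: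
  fixes M :: "'i \<Rightarrow> 'j \<Rightarrow> 'a::field" and b :: "'i \<Rightarrow> 'a"
  assumes "finite I" "finite J"
    and "\<And>y. (\<And>j. j \<in> J \<Longrightarrow> (\<Sum>i\<in>I. y i * M i j) = 0) \<Longrightarrow> \<forall>i\<in>I. y i = 0"
  shows "\<exists>x. \<forall>i\<in>I. (\<Sum>j\<in>J. M i j * x j) = b i"
  using assms(1,3)
proof (induction I arbitrary: b rule: finite_induct)
  case empty
  then show ?case by simp
next
  case (insert i0 I b)
  have restr: "\<forall>i\<in>I. y i = 0" if y: "\<And>j. j \<in> J \<Longrightarrow> (\<Sum>i\<in>I. y i * M i j) = 0" for y
  proof -
    have "\<forall>i\<in>insert i0 I. (if i = i0 then 0 else y i) = 0"
    proof (rule insert.prems)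
      fix j assume "j \<in> J"
      have "(\<Sum>i\<in>I. (if i = i0 then 0 else y i) * M i j) = (\<Sum>i\<in>I. y i * M i j)"
        by (rule sum.cong) (use insert.hyps in auto)
      then show "(\<Sum>i\<in>insert i0 I. (if i = i0 then 0 else y i) * M i j) = 0"
        using insert.hyps y[OF \<open>j \<in> J\<close>] by simp
    qed
    then show ?thesis using insert.hyps by (metis insertI2)
  qed
  have solv: "\<exists>x. \<forall>i\<in>I. (\<Sum>j\<in>J. M i j * x j) = b' i" for b'
    by (rule insert.IH) (use restr in blast)
  define S where "S i x = (\<Sum>j\<in>J. M i j * x j)" for i x
  have "\<forall>i. \<exists>x. \<forall>i'\<in>I. S i' x = (if i' = i then 1 else 0)"
  proof
    show "\<exists>x. \<forall>i'\<in>I. S i' x = (if i' = i then 1 else 0)" for i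
      using solv[of "\<lambda>i'. if i' = i then 1 else 0"] unfolding S_def .
  qed
  \<comment> \<open>The vectors \<open>e i\<close> are dual to the old rows, so subtracting the sum
    of \<open>S i' x * e i'\<close> projects \<open>x\<close> into their common kernel.\<close>
  then obtain e where e: "\<And>i i'. i' \<in> I \<Longrightarrow> S i' (e i) = (if i' = i then 1 else 0)"
    by metis
  have S_lin: "S i (\<lambda>j. x j - (\<Sum>i'\<in>I. c i' * e i' j)) = S i x - (\<Sum>i'\<in>I. c i' * S i (e i'))"
    for i x c
  proof -
    have "S i (\<lambda>j. x j - (\<Sum>i'\<in>I. c i' * e i' j)) = S i x - (\<Sum>j\<in>J. \<Sum>i'\<in>I. c i' * (M i j * e i' j))"
      by (simp add: S_def right_diff_distrib sum_subtractf sum_distrib_left mult_ac)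
    also have "(\<Sum>j\<in>J. \<Sum>i'\<in>I. c i' * (M i j * e i' j)) = (\<Sum>i'\<in>I. c i' * S i (e i'))"
      by (subst sum.swap) (simp add: S_def sum_distrib_left)
    finally show ?thesis .
  qed
  have kill: "S i (\<lambda>j. x j - (\<Sum>i'\<in>I. S i' x * e i' j)) = 0" if "i \<in> I" for i x
  proof -
    have "(\<Sum>i'\<in>I. S i' x * S i (e i')) = (\<Sum>i'\<in>I. if i = i' then S i' x else 0)"
      by (rule sum.cong) (use e[OF that] in auto)
    also have "\<dots> = S i x" using that insert.hyps by simp
    finally show ?thesis unfolding S_lin by simp
  qed
  have "\<exists>z. (\<forall>i\<in>I. S i z = 0) \<and> S i0 z \<noteq> 0"
  proof (rule ccontr)
    assume none: "\<not> ?thesis"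
    \<comment> \<open>If row \<open>i0\<close> vanishes on the kernel, applying it to projected unit
      vectors writes it as the combination of the old rows with coefficients
      \<open>S i0 (e i)\<close>; \<open>y\<close> is the resulting forbidden relation.\<close>
    define y where "y i = (if i = i0 then 1 else - S i0 (e i))" for i
    have "\<forall>i\<in>insert i0 I. y i = 0"
    proof (rule insert.prems)
      fix j assume j: "j \<in> J"
      define u where "u j' = (if j' = j then 1 else 0 :: 'a)" for j'
      have Su: "S i u = M i j" for i
        using j assms(2) by (simp add: S_def u_def if_distrib cong: if_cong)
      have "S i0 (\<lambda>j. u j - (\<Sum>i'\<in>I. S i' u * e i' j)) = 0"
        using none kill by blast
      then have "M i0 j - (\<Sum>i\<in>I. M i j * S i0 (e i)) = 0" unfolding S_lin Su .
      moreover have "(\<Sum>i\<in>I. y i * M i j) = - (\<Sum>i\<in>I. M i j * S i0 (e i))"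
        unfolding sum_negf[symmetric] by (rule sum.cong) (use insert.hyps in \<open>auto simp: y_def\<close>)
      ultimately show "(\<Sum>i\<in>insert i0 I. y i * M i j) = 0"
        using insert.hyps by (simp add: y_def)
    qed
    then show False by (auto simp: y_def)
  qed
  then obtain z where z: "\<And>i. i \<in> I \<Longrightarrow> S i z = 0" "S i0 z \<noteq> 0" by blast
  obtain x where x: "\<And>i. i \<in> I \<Longrightarrow> S i x = b i" using solv[of b] unfolding S_def by blast
  define c where "c = (b i0 - S i0 x) / S i0 z"
  have "S i (\<lambda>j. x j + c * z j) = S i x + c * S i z" for i
    by (simp add: S_def distrib_left sum.distrib sum_distrib_left mult_ac)
  then have "\<forall>i\<in>insert i0 I. S i (\<lambda>j. x j + c * z j) = b i"
    using x z by (auto simp: c_def)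
  then show ?case unfolding S_def by (intro exI[of _ "\<lambda>j. x j + c * z j"])
qed

text \<open>\<open>F\<close> may be nonlinear. By causality and the factor \<open>fps_X\<close>,
  coefficient \<open>N\<close> of the right-hand side involves only the coefficients of
  \<open>x\<close> below \<open>N\<close>. The coefficients are thus found one after another, each
  from a system with the constant matrix \<open>M\<close>.\<close>

lemma fps_perturbation_solvable:
  fixes M :: "'i \<Rightarrow> 'j \<Rightarrow> 'a::field" and F :: "('j \<Rightarrow> 'a fps) \<Rightarrow> 'i \<Rightarrow> 'a fps"
  assumes solv: "\<And>b. \<exists>x. \<forall>i\<in>I. (\<Sum>j\<in>J. M i j * x j) = b i"
    and causal: "\<And>x y N i. (\<And>j n. n \<le> N \<Longrightarrow> fps_nth (x j) n = fps_nth (y j) n) \<Longrightarrow>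
      fps_nth (F x i) N = fps_nth (F y i) N"
  shows "\<exists>x. \<forall>i\<in>I. (\<Sum>j\<in>J. fps_const (M i j) * x j) = fps_X * F x i"
proof -
  define P where "P f N r \<longleftrightarrow>
    (\<forall>i\<in>I. (\<Sum>j\<in>J. M i j * r j) = fps_nth (fps_X * F (\<lambda>j. Abs_fps (\<lambda>n. f n j)) i) N)"
    for f :: "nat \<Rightarrow> 'j \<Rightarrow> 'a" and N r
  have "\<exists>f. \<forall>N. P f N (f N)"
  proof (rule dependent_wf_choice[of less_than])
    show "P f N r = P g N r" if "\<And>z. (z, N) \<in> less_than \<Longrightarrow> f z = g z" for f g N r
    proof -
      have "fps_nth (fps_X * F (\<lambda>j. Abs_fps (\<lambda>n. f n j)) i) N =
        fps_nth (fps_X * F (\<lambda>j. Abs_fps (\<lambda>n. g n j)) i) N" for i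
        using that by (cases N) (auto intro!: causal)
      then show ?thesis unfolding P_def by simp
    qed
    show "\<exists>r. P f N r" for f N
      unfolding P_def by (rule solv)
  qed auto
  then obtain f where f: "\<And>N. P f N (f N)" by blast
  show ?thesis
  proof (intro exI ballI fps_ext)
    fix i N assume "i \<in> I"
    then show "fps_nth (\<Sum>j\<in>J. fps_const (M i j) * Abs_fps (\<lambda>n. f n j)) N =
      fps_nth (fps_X * F (\<lambda>j. Abs_fps (\<lambda>n. f n j)) i) N"
      using f[of N] by (simp add: P_def fps_sum_nth)
  qed
qed

subsection \<open>Forms with surjective linearised isotropy equations\<close>

text \<open>A cycle of length at least 2 can be properly coloured with three colours, and an
  algebraically closed field has at least three elements.\<close>

lemma cyclically_distinct_sequence:
  assumes "t \<ge> 2"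
  shows "\<exists>\<tau>::nat \<Rightarrow> 'a::alg_closed_field. \<forall>j<t. \<tau> (Suc j mod t) \<noteq> \<tau> j"
proof -
  have "\<exists>z::'a. z \<noteq> 0 \<and> z \<noteq> 1"
  proof (cases "(2::'a) = 0")
    case True
    \<comment> \<open>In characteristic 2 the elements -1 and 1 coincide, so the third element is
      taken to be a root of \<open>X^2 + X + 1\<close>.\<close>
    have "degree [:1, 1, 1::'a:] = 2" by simp
    then obtain z :: 'a where z: "poly [:1, 1, 1:] z = 0"
      using alg_closed_imp_poly_has_root[of "[:1, 1, 1::'a:]"] by auto
    have "poly [:1, 1, 1:] (0::'a) = 1" "poly [:1, 1, 1:] (1::'a) = 1 + 2" by simp_all
    then have "poly [:1, 1, 1:] (0::'a) \<noteq> 0" "poly [:1, 1, 1:] (1::'a) \<noteq> 0"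
      unfolding True by simp_all
    then have "z \<noteq> 0" "z \<noteq> 1" using z by (blast, blast)
    then show ?thesis by blast
  next
    case False
    have "(-1::'a) \<noteq> 1"
    proof
      assume "(-1::'a) = 1"
      then have "(1::'a) + 1 = -1 + 1" by (simp only:)
      then show False using False by simp
    qed
    then show ?thesis by (intro exI[of _ "-1"]) simp
  qed
  then obtain z :: 'a where z: "z \<noteq> 0" "z \<noteq> 1" by blast
  \<comment> \<open>The values 0 and 1 alternate; for odd \<open>t\<close> this would clash at the
    wrap-around, so the last entry becomes \<open>z\<close>.\<close>
  define \<tau> :: "nat \<Rightarrow> 'a" where
    "\<tau> j = (if odd t \<and> j = t - 1 then z else if even j then 0 else 1)" for j
  have "\<tau> (Suc j mod t) \<noteq> \<tau> j" if "j < t" for j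
  proof (cases "Suc j = t")
    case True
    then have "j = t - 1" "j > 0" using assms by auto
    have "Suc j mod t = 0" using True by simp
    moreover have "\<tau> 0 = 0" using \<open>j > 0\<close> \<open>j = t - 1\<close> by (simp add: \<tau>_def)
    moreover have "\<tau> j \<noteq> 0"
      using z(1) True by (cases "even j") (auto simp: \<tau>_def)
    ultimately show ?thesis by simp
  next
    case False
    then have "Suc j mod t = Suc j" "j \<noteq> t - 1" using that by auto
    then show ?thesis using z by (cases "even j") (simp_all add: \<tau>_def)
  qed
  then show ?thesis by blast
qed

definition pairing :: "nat \<Rightarrow> nat \<Rightarrow> (nat \<Rightarrow> nat \<Rightarrow> 'a::field) \<Rightarrow> (nat \<Rightarrow> nat \<Rightarrow> 'a) \<Rightarrow> 'a" where
  "pairing t k c b = (\<Sum>j<t. \<Sum>a<k. c j a * b j a)"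

definition unit_tensor :: "nat \<Rightarrow> nat \<Rightarrow> nat \<Rightarrow> nat \<Rightarrow> 'a::field" where
  "unit_tensor j a = (\<lambda>j' a'. if j' = j \<and> a' = a then 1 else 0)"

text \<open>The zero diagonal is demanded separately because skew symmetry does not imply it in
  characteristic 2.\<close>

definition skew_family :: "(nat \<Rightarrow> nat \<Rightarrow> nat \<Rightarrow> 'a::field) \<Rightarrow> bool" where
  "skew_family S \<longleftrightarrow> (\<forall>j a c. S j a c = - S j c a) \<and> (\<forall>j a. S j a a = 0)"

text \<open>
  Injectivity of the transposed linearised equations: \<open>S\<close> is a \<open>t\<close>-tuple of alternating
  \<open>k \<times> k\<close> matrices, and \<open>b l\<close> is a tensor in \<open>K\<^sup>t \<otimes> K\<^sup>k\<close>.
\<close>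

definition separating :: "nat \<Rightarrow> nat \<Rightarrow> nat \<Rightarrow> (nat \<Rightarrow> nat \<Rightarrow> nat \<Rightarrow> 'a::field) \<Rightarrow> bool" where
  "separating t k m b \<longleftrightarrow>
    (\<forall>S. skew_family S \<and> (\<forall>l<m. \<forall>c<k. pairing t k (\<lambda>j. S j c) (b l) = 0) \<longrightarrow>
      (\<forall>j<t. \<forall>a<k. \<forall>c<k. S j a c = 0))"

text \<open>
  The invariant that carries the induction from \<open>k\<close> to \<open>k + 2\<close>: with \<open>T = diag \<tau>\<close>, a functional
  killing both \<open>W = span b\<close> and \<open>T W\<close> is determined by its last column.
\<close>

definition twist_separating ::
    "nat \<Rightarrow> (nat \<Rightarrow> 'a::field) \<Rightarrow> nat \<Rightarrow> nat \<Rightarrow> (nat \<Rightarrow> nat \<Rightarrow> nat \<Rightarrow> 'a) \<Rightarrow> bool" where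
  "twist_separating t \<tau> k m b \<longleftrightarrow>
    (\<forall>c. (\<forall>l<m. pairing t k c (b l) = 0 \<and> pairing t k (\<lambda>j a. \<tau> j * c j a) (b l) = 0) \<and>
        (\<forall>j<t. c j (k - 1) = 0) \<longrightarrow>
      (\<forall>j<t. \<forall>a<k. c j a = 0))"

lemma pairing_add: "pairing t k c (\<lambda>j a. b j a + b' j a) = pairing t k c b + pairing t k c b'"
  by (simp add: pairing_def distrib_left sum.distrib)

lemma pairing_smult: "pairing t k c (\<lambda>j a. x * b j a) = x * pairing t k c b"
  by (simp add: pairing_def sum_distrib_left mult_ac)

lemma pairing_neg: "pairing t k (\<lambda>j a. - c j a) b = - pairing t k c b"
  by (simp add: pairing_def sum_negf)

lemma pairing_unit_tensor:
  assumes "j < t" "a < k"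
  shows "pairing t k c (unit_tensor j a) = c j a"
proof -
  have "pairing t k c (unit_tensor j a) = (\<Sum>j'<t. if j' = j then c j a else 0)"
    unfolding pairing_def
    by (rule sum.cong) (use assms in \<open>auto simp: unit_tensor_def if_distrib cong: if_cong\<close>)
  then show ?thesis using assms by simp
qed

lemma pairing_pad:
  assumes "\<And>j a. a \<ge> k \<Longrightarrow> b j a = 0" "k \<le> k'"
  shows "pairing t k' c b = pairing t k c b"
  unfolding pairing_def
  by (intro sum.cong refl sum.mono_neutral_right) (use assms in auto)

text \<open>
  The new tensors are \<open>e\<^sub>k\<^sub>-\<^sub>1 \<otimes> P f + e\<^sub>k \<otimes> f + e\<^sub>k\<^sub>+\<^sub>1 \<otimes> T f\<close> for the basis vectors \<open>f\<close> of \<open>K\<^sup>t\<close>,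
  where \<open>P\<close> is the cyclic shift. Everything rests on the commutator of \<open>T\<close> and \<open>P\<close> being invertible.
\<close>

lemma separating_step:
  fixes b :: "nat \<Rightarrow> nat \<Rightarrow> nat \<Rightarrow> 'a::field"
  assumes t: "t > 0" and \<tau>: "\<And>j. j < t \<Longrightarrow> \<tau> (Suc j mod t) \<noteq> \<tau> j"
    and k: "k > 0" and supp: "\<And>l j a. a \<ge> k \<Longrightarrow> b l j a = 0"
    and sep: "separating t k m b" and tw: "twist_separating t \<tau> k m b"
  shows "\<exists>b'. (\<forall>l j a. a \<ge> k + 2 \<longrightarrow> b' l j a = 0) \<and>
    separating t (k + 2) (m + t) b' \<and> twist_separating t \<tau> (k + 2) (m + t) b'"
proof -
  define \<pi> where "\<pi> j = Suc j mod t" for j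
  define b' where "b' l = (if l < m then b l else
     (\<lambda>j a. unit_tensor (\<pi> (l - m)) (k - 1) j a + (unit_tensor (l - m) k j a
        + \<tau> (l - m) * unit_tensor (l - m) (k + 1) j a)))" for l
  have \<pi>_less: "\<pi> j < t" for j using t by (simp add: \<pi>_def)
  have \<pi>_surj: "\<exists>i<t. \<pi> i = j" if "j < t" for j
  proof (cases j)
    case 0
    then show ?thesis using t by (intro exI[of _ "t - 1"]) (simp add: \<pi>_def)
  next
    case (Suc i)
    then show ?thesis using that by (intro exI[of _ i]) (simp add: \<pi>_def)
  qed
  have \<tau>': "\<tau> (\<pi> j) \<noteq> \<tau> j" if "j < t" for j using \<tau>[OF that] by (simp add: \<pi>_def)
  have old: "pairing t (k + 2) c (b' l) = pairing t k c (b l)" if "l < m" for l c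
    using that pairing_pad[of k "b l" "k + 2" t c] supp by (simp add: b'_def)
  have new: "pairing t (k + 2) c (b' (m + j)) = c (\<pi> j) (k - 1) + (c j k + \<tau> j * c j (k + 1))"
    if "j < t" for j c
    using that k by (simp add: b'_def pairing_add pairing_smult pairing_unit_tensor \<pi>_less)
  have "separating t (k + 2) (m + t) b'"
    unfolding separating_def
  proof (intro allI impI, elim conjE)
    fix S j a c
    assume S: "skew_family S"
      and eq: "\<forall>l<m + t. \<forall>c<k + 2. pairing t (k + 2) (\<lambda>j. S j c) (b' l) = 0"
      and jac: "j < t" "a < k + 2" "c < k + 2"
    have skew: "S j a c = - S j c a" "S j a a = 0" for j a c
      using S unfolding skew_family_def by blast+
    have eq_old: "pairing t k (\<lambda>j. S j c) (b l) = 0" if "l < m" "c < k + 2" for l c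
      using eq[rule_format, of l c] that old[of l "\<lambda>j. S j c"] by simp
    have eq_new: "S (\<pi> j) c (k - 1) + (S j c k + \<tau> j * S j c (k + 1)) = 0" if "j < t" "c < k + 2" for j c
      using eq that new[of j "\<lambda>j. S j c"] by simp
    have S_old: "S j a c = 0" if "j < t" "a < k" "c < k" for j a c
      using sep[unfolded separating_def, rule_format, of S] S eq_old that by simp
    \<comment> \<open>In column \<open>a < k\<close>, the shifted term of a new equation lies in the
      old block and vanishes; what remains ties row \<open>k\<close> to the \<tau>-twist of row
      \<open>k + 1\<close>.\<close>
    have x_y: "S j k a = - \<tau> j * S j (k + 1) a" if "j < t" "a < k" for j a
    proof -
      have "S j a k + \<tau> j * S j a (k + 1) = 0"
        using eq_new[of j a] S_old[OF \<pi>_less, of a "k - 1"] that k by simp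
      then have "S j a k = - (\<tau> j * S j a (k + 1))" by (simp add: eq_neg_iff_add_eq_0)
      then show ?thesis
        using skew(1)[of j k a] skew(1)[of j a "k + 1"] by simp
    qed
    \<comment> \<open>The equations in columns \<open>k + 1\<close> and \<open>k\<close> form a 2 by
      2 system in these two entries, with determinant \<tau>(\<pi> j) - \<tau>(j) up to sign. This
      is where the commutator of \<open>T\<close> and \<open>P\<close> enters.\<close>
    have last: "S (\<pi> j) (k + 1) (k - 1) = 0" "S j (k + 1) k = 0" if j: "j < t" for j
    proof -
      have "S (\<pi> j) (k + 1) (k - 1) + S j (k + 1) k = 0"
        using eq_new[OF j, of "k + 1"] by (simp add: skew(2))
      moreover have "\<tau> (\<pi> j) * S (\<pi> j) (k + 1) (k - 1) + \<tau> j * S j (k + 1) k = 0"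
        using eq_new[OF j, of k] x_y[OF \<pi>_less, of "k - 1" j] k
        by (simp add: skew(2) skew(1)[of j k "Suc k"] add_eq_0_iff)
      ultimately have "(\<tau> (\<pi> j) - \<tau> j) * S (\<pi> j) (k + 1) (k - 1) = 0"
        by (simp add: add_eq_0_iff algebra_simps)
      then show "S (\<pi> j) (k + 1) (k - 1) = 0" using \<tau>'[OF j] by simp
      then show "S j (k + 1) k = 0"
        using \<open>S (\<pi> j) (k + 1) (k - 1) + S j (k + 1) k = 0\<close> by simp
    qed
    \<comment> \<open>Restricted to the old columns, row \<open>k + 1\<close> kills
      \<open>W\<close>, and so does its twist, which is minus row \<open>k\<close>. Its column
      \<open>k - 1\<close> is zero by \<open>last\<close> and surjectivity of \<pi>, so the
      invariant makes it vanish.\<close>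
    have y_old: "S j (k + 1) a = 0" if "j < t" "a < k" for j a
    proof -
      have "pairing t k (\<lambda>j a. \<tau> j * S j (k + 1) a) (b l) = 0" if "l < m" for l
      proof -
        have "pairing t k (\<lambda>j a. \<tau> j * S j (k + 1) a) (b l) = pairing t k (\<lambda>j a. - S j k a) (b l)"
          unfolding pairing_def by (intro sum.cong refl) (simp add: x_y)
        then show ?thesis using eq_old[OF that, of k] by (simp add: pairing_neg)
      qed
      moreover have "S j (k + 1) (k - 1) = 0" if "j < t" for j
        using last(1) \<pi>_surj[OF that] by blast
      ultimately show ?thesis
        using tw[unfolded twist_separating_def, rule_format, of "\<lambda>j. S j (k + 1)"] eq_old that
        by simp
    qed
    have x_old: "S j k a = 0" if "j < t" "a < k" for j a
      using x_y[OF that] y_old[OF that] by simp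
    have split: "a < k \<or> a = k \<or> a = k + 1" "c < k \<or> c = k \<or> c = k + 1" using jac by linarith+
    have "S j a c = 0 \<or> S j c a = 0"
      using split jac(1) S_old x_old y_old last(2) skew(2) by (elim disjE) simp_all
    then show "S j a c = 0" using skew(1)[of j a c] by auto
  qed
  moreover have "twist_separating t \<tau> (k + 2) (m + t) b'"
    unfolding twist_separating_def
  proof (intro allI impI, elim conjE)
    fix c j a
    assume eq: "\<forall>l<m + t. pairing t (k + 2) c (b' l) = 0 \<and>
        pairing t (k + 2) (\<lambda>j a. \<tau> j * c j a) (b' l) = 0"
      and c0: "\<forall>j<t. c j (k + 2 - 1) = 0" and ja: "j < t" "a < k + 2"
    have eq1: "c (\<pi> j) (k - 1) + c j k = 0" if "j < t" for j
      using eq that new[OF that, of c] c0 by simp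
    have eq2: "\<tau> (\<pi> j) * c (\<pi> j) (k - 1) + \<tau> j * c j k = 0" if "j < t" for j
      using eq that new[OF that, of "\<lambda>j a. \<tau> j * c j a"] c0 by simp
    \<comment> \<open>With the last column zero, the functional and its twist give the same 2 by 2
      determinant as before; columns \<open>k\<close> and \<open>k - 1\<close> vanish and the old
      invariant handles the rest.\<close>
    have z: "c (\<pi> j) (k - 1) = 0" if "j < t" for j
    proof -
      have "(\<tau> (\<pi> j) - \<tau> j) * c (\<pi> j) (k - 1) = 0"
        using eq1[OF that] eq2[OF that] by (simp add: add_eq_0_iff algebra_simps)
      then show ?thesis using \<tau>'[OF that] by simp
    qed
    have "c j k = 0" if "j < t" for j using eq1[OF that] z[OF that] by simp
    moreover have "c j (k - 1) = 0" if "j < t" for j using z \<pi>_surj[OF that] by blast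
    moreover have "pairing t k c (b l) = 0 \<and> pairing t k (\<lambda>j a. \<tau> j * c j a) (b l) = 0" if "l < m" for l
      using eq[rule_format, of l] that old[OF that] by simp
    ultimately have c_old: "c j a = 0" if "j < t" "a < k" for j a
      using tw[unfolded twist_separating_def, rule_format, of c, OF conjI] that by blast
    have "c j k = 0" using eq1[OF ja(1)] z[OF ja(1)] by simp
    moreover have "c j (k + 1) = 0" using c0 ja(1) by simp
    moreover have "a < k \<or> a = k \<or> a = k + 1" using ja by linarith
    ultimately show "c j a = 0" using c_old[OF ja(1)] by metis
  qed
  moreover have "\<forall>l j a. a \<ge> k + 2 \<longrightarrow> b' l j a = 0"
    using k by (auto simp: b'_def supp unit_tensor_def)
  ultimately show ?thesis by blast
qed

text \<open>An alternating 2 by 2 matrix has one free entry, and each tensor contributes two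
  equations. A tensor supported on two cyclically adjacent forms therefore settles both, so half of
  \<open>t\<close>, rounded up, suffices; for odd \<open>t\<close> the last tensor wraps around to
  form 0.\<close>

lemma separating_base_two:
  fixes \<tau> :: "nat \<Rightarrow> 'a::field"
  assumes t: "t \<ge> 2" and \<tau>: "\<And>j. j < t \<Longrightarrow> \<tau> (Suc j mod t) \<noteq> \<tau> j"
  shows "\<exists>b. (\<forall>l j a. a \<ge> 2 \<longrightarrow> b l j a = 0) \<and>
    separating t 2 ((t + 1) div 2) b \<and> twist_separating t \<tau> 2 ((t + 1) div 2) b"
proof -
  define \<pi> where "\<pi> j = Suc j mod t" for j
  define m where "m = (t + 1) div 2"
  define b :: "nat \<Rightarrow> nat \<Rightarrow> nat \<Rightarrow> 'a" where "b l = (\<lambda>j a.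
     (unit_tensor (2 * l) 0 j a + \<tau> (2 * l) * unit_tensor (2 * l) 1 j a) +
     (unit_tensor (\<pi> (2 * l)) 0 j a + \<tau> (\<pi> (2 * l)) * unit_tensor (\<pi> (2 * l)) 1 j a))" for l
  have \<pi>_less: "\<pi> j < t" for j using t by (simp add: \<pi>_def)
  have cover: "\<exists>l<m. j = 2 * l \<or> j = \<pi> (2 * l)" if "j < t" for j
  proof (cases "even j")
    case True
    then show ?thesis using that by (intro exI[of _ "j div 2"]) (auto simp: m_def)
  next
    case False
    then have "j = Suc (2 * (j div 2))" by presburger
    then show ?thesis using that by (intro exI[of _ "j div 2"]) (auto simp: \<pi>_def m_def)
  qed
  have l2: "2 * l < t" if "l < m" for l using that by (auto simp: m_def)
  have pr: "pairing t 2 c (b l) = (c (2 * l) 0 + \<tau> (2 * l) * c (2 * l) 1) +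
     (c (\<pi> (2 * l)) 0 + \<tau> (\<pi> (2 * l)) * c (\<pi> (2 * l)) 1)" if "l < m" for l c
    using l2[OF that] by (simp add: b_def pairing_add pairing_smult pairing_unit_tensor \<pi>_less)
  have both: "x (2 * l) = 0 \<and> x (\<pi> (2 * l)) = 0"
    if "l < m" "x (2 * l) + x (\<pi> (2 * l)) = 0"
      "\<tau> (2 * l) * x (2 * l) + \<tau> (\<pi> (2 * l)) * x (\<pi> (2 * l)) = 0" for l and x :: "nat \<Rightarrow> 'a"
  proof -
    have "(\<tau> (\<pi> (2 * l)) - \<tau> (2 * l)) * x (\<pi> (2 * l)) = 0"
      using that by (simp add: add_eq_0_iff algebra_simps)
    then show ?thesis using \<tau>[OF l2[OF that(1)]] that(2) by (simp add: \<pi>_def)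
  qed
  have "separating t 2 m b"
    unfolding separating_def
  proof (intro allI impI, elim conjE)
    fix S j a c
    assume S: "skew_family S"
      and eq: "\<forall>l<m. \<forall>c<2. pairing t 2 (\<lambda>j. S j c) (b l) = 0"
      and jac: "j < t" "a < (2::nat)" "c < (2::nat)"
    have skew: "S j a c = - S j c a" "S j a a = 0" for j a c
      using S unfolding skew_family_def by blast+
    have "S (2 * l) 1 0 = 0 \<and> S (\<pi> (2 * l)) 1 0 = 0" if l: "l < m" for l
    proof (rule both[OF l, of "\<lambda>j. S j 1 0"])
      show "S (2 * l) 1 0 + S (\<pi> (2 * l)) 1 0 = 0"
        using eq[rule_format, OF l, of 1] pr[OF l, of "\<lambda>j. S j 1"] by (simp add: skew(2))
      show "\<tau> (2 * l) * S (2 * l) 1 0 + \<tau> (\<pi> (2 * l)) * S (\<pi> (2 * l)) 1 0 = 0"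
        using eq[rule_format, OF l, of 0] pr[OF l, of "\<lambda>j. S j 0"]
        by (simp add: skew(2) skew(1)[of _ 0 "Suc 0"] add_eq_0_iff)
    qed
    then have "S j 1 0 = 0" using cover[OF jac(1)] by blast
    moreover have "a = 0 \<or> a = 1" "c = 0 \<or> c = 1" using jac by linarith+
    ultimately show "S j a c = 0"
      using skew(2) skew(1)[of j 0 1] by (elim disjE) simp_all
  qed
  moreover have "twist_separating t \<tau> 2 m b"
    unfolding twist_separating_def
  proof (intro allI impI, elim conjE)
    fix c j a
    assume eq: "\<forall>l<m. pairing t 2 c (b l) = 0 \<and> pairing t 2 (\<lambda>j a. \<tau> j * c j a) (b l) = 0"
      and c0: "\<forall>j<t. c j (2 - 1) = 0" and ja: "j < t" "a < (2::nat)"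
    have "c (2 * l) 0 = 0 \<and> c (\<pi> (2 * l)) 0 = 0" if l: "l < m" for l
    proof (rule both[OF l, of "\<lambda>j. c j 0"])
      show "c (2 * l) 0 + c (\<pi> (2 * l)) 0 = 0"
        using eq[rule_format, OF l] pr[OF l, of c] c0 l2[OF l] \<pi>_less by simp
      show "\<tau> (2 * l) * c (2 * l) 0 + \<tau> (\<pi> (2 * l)) * c (\<pi> (2 * l)) 0 = 0"
        using eq[rule_format, OF l] pr[OF l, of "\<lambda>j a. \<tau> j * c j a"] c0 l2[OF l] \<pi>_less by simp
    qed
    then have "c j 0 = 0" using cover[OF ja(1)] by blast
    then show "c j a = 0" using ja c0 by (cases a) auto
  qed
  moreover have "\<forall>l j a. a \<ge> 2 \<longrightarrow> b l j a = 0"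
    by (auto simp: b_def unit_tensor_def)
  ultimately show ?thesis unfolding m_def by blast
qed

lemma separating_base_one:
  fixes \<tau> :: "nat \<Rightarrow> 'a::field"
  shows "separating t 1 0 (\<lambda>_ _ _. 0::'a)" "twist_separating t \<tau> 1 0 (\<lambda>_ _ _. 0)"
proof -
  show "separating t 1 0 (\<lambda>_ _ _. 0::'a)"
    unfolding separating_def skew_family_def by (metis less_one)
  show "twist_separating t \<tau> 1 0 (\<lambda>_ _ _. 0)"
    by (simp add: twist_separating_def)
qed

text \<open>Starting from 1 or 2 according to the parity of \<open>k\<close>, each step raises
  \<open>k\<close> by 2 at the cost of \<open>t\<close> tensors. The total is
  \<open>t * (k - 1) / 2\<close>, rounded up.\<close>

lemma ex_separating:
  assumes t: "t \<ge> 2" and k: "k > 0" and m: "2 * m \<ge> t * (k - 1)"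
  shows "\<exists>b :: nat \<Rightarrow> nat \<Rightarrow> nat \<Rightarrow> 'a::alg_closed_field. separating t k m b"
proof -
  obtain \<tau> :: "nat \<Rightarrow> 'a" where \<tau>: "\<And>j. j < t \<Longrightarrow> \<tau> (Suc j mod t) \<noteq> \<tau> j"
    using cyclically_distinct_sequence[OF t] by blast
  define good where "good k m \<longleftrightarrow> (\<exists>b. (\<forall>l j a. a \<ge> k \<longrightarrow> b l j a = 0) \<and>
    separating t k m b \<and> twist_separating t \<tau> k m b)" for k m
  have iter: "good (k + 2 * r) (m + r * t)" if "good k m" "k > 0" for k m r
  proof (induction r)
    case (Suc r)
    then obtain b where "\<And>l j a. a \<ge> k + 2 * r \<Longrightarrow> b l j a = 0"
      "separating t (k + 2 * r) (m + r * t) b" "twist_separating t \<tau> (k + 2 * r) (m + r * t) b"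
      unfolding good_def by blast
    from separating_step[OF _ \<tau> _ this] show ?case
      using t that by (simp add: good_def add_ac)
  qed (use that in simp)
  \<comment> \<open>Further tensors only impose more conditions on \<open>S\<close>, so a larger
    count preserves separation whatever the extra tensors are.\<close>
  have mono: "\<exists>b :: nat \<Rightarrow> nat \<Rightarrow> nat \<Rightarrow> 'a. separating t k m b" if good: "good k m'" and "m' \<le> m" for m'
  proof -
    obtain b :: "nat \<Rightarrow> nat \<Rightarrow> nat \<Rightarrow> 'a" where "separating t k m' b" using good unfolding good_def by blast
    then have "separating t k m b" using that(2) by (auto simp: separating_def)
    then show ?thesis by blast
  qed
  show ?thesis
  proof (cases "odd k")
    case True
    then obtain r where r: "k = 1 + 2 * r" by (metis oddE add.commute)
    have "good 1 0" unfolding good_def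
      by (intro exI[of _ "\<lambda>_ _ _. 0"] conjI allI impI separating_base_one refl)
    from iter[OF this, of r] have "good k (r * t)" using r by simp
    then show ?thesis by (rule mono) (use m r in \<open>simp add: mult.commute\<close>)
  next
    case False
    then obtain r where "k = 2 * r" by (auto elim: evenE)
    then obtain r where r: "k = 2 + 2 * r" using k by (cases r) auto
    have "good 2 ((t + 1) div 2)" unfolding good_def using separating_base_two[of t \<tau>, OF t \<tau>] by blast
    from iter[OF this, of r] have "good k ((t + 1) div 2 + r * t)" using r by simp
    moreover have "t * (k - 1) = t + 2 * (r * t)" using r by (simp add: algebra_simps)
    then have "(t + 1) div 2 + r * t \<le> m" using m by linarith
    ultimately show ?thesis by (rule mono)
  qed
qed

subsection \<open>Extension of places\<close>

text \<open>Partial ring homomorphisms are represented by their graphs, so that Zorn's lemma applies to inclusion.\<close>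

definition partial_hom :: "('f::field \<times> 'k::field) set \<Rightarrow> bool" where
  "partial_hom R \<longleftrightarrow> (1, 1) \<in> R \<and>
    (\<forall>x a y b. (x, a) \<in> R \<and> (y, b) \<in> R \<longrightarrow> (x - y, a - b) \<in> R \<and> (x * y, a * b) \<in> R) \<and>
    (\<forall>a. (0, a) \<in> R \<longrightarrow> a = 0)"

lemma partial_homI:
  assumes "(1, 1) \<in> R"
    and "\<And>x a y b. (x, a) \<in> R \<Longrightarrow> (y, b) \<in> R \<Longrightarrow> (x - y, a - b) \<in> R"
    and "\<And>x a y b. (x, a) \<in> R \<Longrightarrow> (y, b) \<in> R \<Longrightarrow> (x * y, a * b) \<in> R"
    and "\<And>a. (0, a) \<in> R \<Longrightarrow> a = 0"
  shows "partial_hom R"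
  using assms unfolding partial_hom_def by blast

context
  fixes R :: "('f::field \<times> 'k::field) set"
  assumes R: "partial_hom R"
begin

lemma partial_hom_one: "(1, 1) \<in> R"
  and partial_hom_diff: "(x, a) \<in> R \<Longrightarrow> (y, b) \<in> R \<Longrightarrow> (x - y, a - b) \<in> R"
  and partial_hom_mult: "(x, a) \<in> R \<Longrightarrow> (y, b) \<in> R \<Longrightarrow> (x * y, a * b) \<in> R"
  and partial_hom_zero_unique: "(0, a) \<in> R \<Longrightarrow> a = 0"
  using R unfolding partial_hom_def by blast+

lemma partial_hom_zero: "(0, 0) \<in> R"
  using partial_hom_diff[OF partial_hom_one partial_hom_one] by simp

lemma partial_hom_add: "(x, a) \<in> R \<Longrightarrow> (y, b) \<in> R \<Longrightarrow> (x + y, a + b) \<in> R"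
  using partial_hom_diff[of x a "0 - y" "0 - b"] partial_hom_diff[OF partial_hom_zero, of y b]
  by simp

lemma partial_hom_unique: "(x, a) \<in> R \<Longrightarrow> (x, b) \<in> R \<Longrightarrow> a = b"
  using partial_hom_diff[of x a x b] partial_hom_zero_unique[of "a - b"] by simp

lemma partial_hom_sum: "(\<And>i. i \<in> A \<Longrightarrow> (f i, g i) \<in> R) \<Longrightarrow> (sum f A, sum g A) \<in> R"
  by (induction A rule: infinite_finite_induct) (auto intro: partial_hom_add partial_hom_zero)

lemma partial_hom_power: "(x, a) \<in> R \<Longrightarrow> (x ^ n, a ^ n) \<in> R"
  by (induction n) (auto intro: partial_hom_mult partial_hom_one)

end

text \<open>Here \<open>q\<close> is the coefficientwise residue of \<open>p\<close>, whose degree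
  may be smaller. In particular \<open>poly_rel R p 1\<close> says that the constant coefficient has
  residue 1 and all others have residue 0.\<close>

definition poly_rel :: "('f::field \<times> 'k::field) set \<Rightarrow> 'f poly \<Rightarrow> 'k poly \<Rightarrow> bool" where
  "poly_rel R p q \<longleftrightarrow> (\<forall>i. (coeff p i, coeff q i) \<in> R)"

lemma poly_rel_const: "partial_hom R \<Longrightarrow> (x, a) \<in> R \<Longrightarrow> poly_rel R [:x:] [:a:]"
  by (auto simp: poly_rel_def coeff_pCons partial_hom_zero split: nat.splits)

lemma poly_rel_diff: "partial_hom R \<Longrightarrow> poly_rel R p q \<Longrightarrow> poly_rel R p' q' \<Longrightarrow> poly_rel R (p - p') (q - q')"
  by (auto simp: poly_rel_def intro: partial_hom_diff)

lemma poly_rel_mult: "partial_hom R \<Longrightarrow> poly_rel R p q \<Longrightarrow> poly_rel R p' q' \<Longrightarrow> poly_rel R (p * p') (q * q')"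
  by (auto simp: poly_rel_def coeff_mult intro!: partial_hom_sum partial_hom_mult)

lemma poly_rel_lift:
  assumes R: "partial_hom R" and surj: "\<And>a. \<exists>x. (x, a) \<in> R"
  shows "\<exists>p. poly_rel R p q"
proof (induction q)
  case 0
  have "poly_rel R 0 0" using R by (simp add: poly_rel_def partial_hom_zero)
  then show ?case by blast
next
  case (pCons a q)
  then obtain p where p: "poly_rel R p q" by blast
  obtain x where "(x, a) \<in> R" using surj by blast
  then have "poly_rel R (pCons x p) (pCons a q)"
    using p by (auto simp: poly_rel_def coeff_pCons split: nat.splits)
  then show ?case by blast
qed

text \<open>Multiplying the value by \<open>b ^ d\<close> gives an element of the domain of
  \<open>R\<close>. Only the constant coefficient of \<open>p\<close> has nonzero residue, so its
  residue is \<open>\<beta> ^ d\<close>, which is nonzero. Hence nothing obstructs adjoining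
  \<open>inverse b\<close>.\<close>

lemma poly_rel_reverse_eval:
  assumes R: "partial_hom R" and p: "poly_rel R p 1" and b: "(b, \<beta>) \<in> R" "b \<noteq> 0" "\<beta> \<noteq> 0"
  shows "poly p (inverse b) \<noteq> 0"
proof
  assume 0: "poly p (inverse b) = 0"
  define d where "d = degree p"
  have "0 = b ^ d * poly p (inverse b)" using 0 by simp
  also have "\<dots> = (\<Sum>i\<le>d. coeff p i * b ^ (d - i))"
    unfolding poly_altdef d_def[symmetric] sum_distrib_left
    by (intro sum.cong refl) (use b in \<open>simp add: power_inverse power_diff divide_inverse mult_ac\<close>)
  finally have "(\<Sum>i\<le>d. coeff p i * b ^ (d - i)) = 0" by simp
  moreover have "((\<Sum>i\<le>d. coeff p i * b ^ (d - i)), (\<Sum>i\<le>d. coeff 1 i * \<beta> ^ (d - i))) \<in> R"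
    using p b by (intro partial_hom_sum[OF R] partial_hom_mult[OF R] partial_hom_power[OF R])
      (auto simp: poly_rel_def)
  ultimately have "(0, \<Sum>i\<le>d. coeff 1 i * \<beta> ^ (d - i)) \<in> R" by (simp only:)
  then have "(\<Sum>i\<le>d. coeff 1 i * \<beta> ^ (d - i)) = 0"
    by (rule partial_hom_zero_unique[OF R])
  moreover have "(\<Sum>i\<le>d. coeff 1 i * \<beta> ^ (d - i)) = (\<Sum>i\<in>{0}. coeff 1 i * \<beta> ^ (d - i))"
    by (intro sum.mono_neutral_right) (auto simp: coeff_1)
  ultimately show False using b by simp
qed

text \<open>
  The residues of the relations satisfied by \<open>x\<close> form an ideal of \<open>K[X]\<close>; if it is proper, then it has a
  zero \<open>\<alpha>\<close>, and \<open>x\<close> can be sent to \<open>\<alpha>\<close>.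
\<close>

lemma partial_hom_adjoin:
  fixes R :: "('f::field \<times> 'k::alg_closed_field) set"
  assumes R: "partial_hom R" and surj: "\<And>a. \<exists>x. (x, a) \<in> R"
    and ideal: "\<And>p. poly_rel R p 1 \<Longrightarrow> poly p x \<noteq> 0"
  shows "\<exists>R' \<alpha>. partial_hom R' \<and> R \<subseteq> R' \<and> (x, \<alpha>) \<in> R'"
proof -
  define I where "I = {q. \<exists>p. poly_rel R p q \<and> poly p x = 0}"
  have I_diff: "q - q' \<in> I" if "q \<in> I" "q' \<in> I" for q q'
  proof -
    obtain p p' where "poly_rel R p q" "poly p x = 0" "poly_rel R p' q'" "poly p' x = 0"
      using \<open>q \<in> I\<close> \<open>q' \<in> I\<close> unfolding I_def by blast
    then show ?thesis
      unfolding I_def using poly_rel_diff[OF R] by (auto intro!: exI[of _ "p - p'"])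
  qed
  have I_mult: "q * q' \<in> I" if "q \<in> I" for q q'
  proof -
    obtain p where "poly_rel R p q" "poly p x = 0" using \<open>q \<in> I\<close> unfolding I_def by blast
    moreover obtain p' where "poly_rel R p' q'" using poly_rel_lift[OF R surj] by blast
    ultimately show ?thesis
      unfolding I_def using poly_rel_mult[OF R] by (auto intro!: exI[of _ "p * p'"])
  qed
  have one: "1 \<notin> I" using ideal unfolding I_def by blast
  have "\<exists>\<alpha>. \<forall>q\<in>I. poly q \<alpha> = 0"
  proof (cases "I \<subseteq> {0}")
    case True
    then have "\<forall>q\<in>I. poly q 0 = 0" by auto
    then show ?thesis by blast
  next
    case False
    \<comment> \<open>An element of minimal degree generates the ideal by division with remainder.
      It is not a unit, so it has a root, which is then common to all of \<open>I\<close>.\<close>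
    define q0 where "q0 = arg_min degree (\<lambda>q. q \<in> I \<and> q \<noteq> 0)"
    have q0: "q0 \<in> I" "q0 \<noteq> 0" and least: "\<And>q. q \<in> I \<Longrightarrow> q \<noteq> 0 \<Longrightarrow> degree q0 \<le> degree q"
      using False arg_min_natI[of "\<lambda>q. q \<in> I \<and> q \<noteq> 0" _ degree]
        arg_min_nat_le[of "\<lambda>q. q \<in> I \<and> q \<noteq> 0" _ degree] unfolding q0_def by blast+
    have "degree q0 > 0"
    proof (rule ccontr)
      assume "\<not> degree q0 > 0"
      then obtain c where c: "q0 = [:c:]" by (auto elim: degree_eq_zeroE)
      have "q0 * [:inverse c:] \<in> I" using I_mult q0 by blast
      then show False using one c q0 by (simp add: one_pCons)
    qed
    then obtain \<alpha> where \<alpha>: "poly q0 \<alpha> = 0" using alg_closed_imp_poly_has_root by blast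
    have "poly q \<alpha> = 0" if q: "q \<in> I" for q
    proof -
      have "q mod q0 = q - q0 * (q div q0)" by (simp add: minus_mult_div_eq_mod)
      then have "q mod q0 \<in> I" using I_diff[OF q I_mult[OF q0(1)]] by simp
      then have "q mod q0 = 0" using least degree_mod_less[OF q0(2), of q] by force
      then show ?thesis using \<alpha> by (auto simp: mod_eq_0_iff_dvd)
    qed
    then show ?thesis by blast
  qed
  then obtain \<alpha> where \<alpha>: "\<And>q. q \<in> I \<Longrightarrow> poly q \<alpha> = 0" by blast
  define R' where "R' = {(poly p x, poly q \<alpha>) | p q. poly_rel R p q}"
  have "partial_hom R'"
  proof (rule partial_homI)
    show "(1, 1) \<in> R'"
      unfolding R'_def using poly_rel_const[OF R partial_hom_one[OF R]]
      by (auto intro!: exI[of _ "[:1:]"])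
    show "(y - z, a - b) \<in> R'" if ya: "(y, a) \<in> R'" and zb: "(z, b) \<in> R'" for y a z b
    proof -
      obtain p q p' q' where "poly_rel R p q" "poly_rel R p' q'"
        "y = poly p x" "a = poly q \<alpha>" "z = poly p' x" "b = poly q' \<alpha>"
        using ya zb unfolding R'_def by blast
      then show ?thesis unfolding R'_def
        by (auto intro!: exI[of _ "p - p'"] exI[of _ "q - q'"] poly_rel_diff[OF R])
    qed
    show "(y * z, a * b) \<in> R'" if ya: "(y, a) \<in> R'" and zb: "(z, b) \<in> R'" for y a z b
    proof -
      obtain p q p' q' where "poly_rel R p q" "poly_rel R p' q'"
        "y = poly p x" "a = poly q \<alpha>" "z = poly p' x" "b = poly q' \<alpha>"
        using ya zb unfolding R'_def by blast
      then show ?thesis unfolding R'_def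
        by (auto intro!: exI[of _ "p * p'"] exI[of _ "q * q'"] poly_rel_mult[OF R])
    qed
    \<comment> \<open>This is well-definedness: a polynomial vanishing at \<open>x\<close> has its
      residue in \<open>I\<close>, hence zero at \<alpha>.\<close>
    show "a = 0" if a: "(0, a) \<in> R'" for a
    proof -
      obtain p q where "poly_rel R p q" "poly p x = 0" "a = poly q \<alpha>"
        using a unfolding R'_def by auto
      then show ?thesis using \<alpha> unfolding I_def by blast
    qed
  qed
  moreover have "R \<subseteq> R'"
  proof
    fix w assume "w \<in> R"
    then obtain y a where w: "w = (y, a)" "(y, a) \<in> R" by (cases w) auto
    show "w \<in> R'"
      unfolding R'_def w(1) using poly_rel_const[OF R w(2)]
      by (auto intro!: exI[of _ "[:y:]"] exI[of _ "[:a:]"])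
  qed
  moreover have "(x, \<alpha>) \<in> R'"
  proof -
    have "poly_rel R [:0, 1:] [:0, 1:]"
      using R by (auto simp: poly_rel_def coeff_pCons partial_hom_zero partial_hom_one split: nat.splits)
    then show ?thesis unfolding R'_def by (auto intro!: exI[of _ "[:0, 1:]"])
  qed
  ultimately show ?thesis by blast
qed

text \<open>The descent in Chevalley's theorem: reversing the relation for \<open>inverse x\<close>
  gives a relation for \<open>x\<close> whose leading coefficient is a unit, and a multiple of it
  cancels the leading term of \<open>p\<close>.\<close>

lemma integral_relation_descent:
  assumes R: "partial_hom R"
    and inv: "\<And>b \<beta>. (b, \<beta>) \<in> R \<Longrightarrow> \<beta> \<noteq> 0 \<Longrightarrow> (inverse b, inverse \<beta>) \<in> R"
    and p: "poly_rel R p 1" "poly p x = 0" and p': "poly_rel R p' 1" "poly p' (inverse x) = 0"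
    and x: "x \<noteq> 0" and deg: "degree p' \<le> degree p"
  shows "\<exists>p''. poly_rel R p'' 1 \<and> poly p'' x = 0 \<and> degree p'' < degree p"
proof -
  define d where "d = degree p"
  define e where "e = degree p'"
  have p0: "(coeff p' 0, 1) \<in> R" "(coeff p d, coeff 1 d) \<in> R"
    using p(1) p'(1)[unfolded poly_rel_def, rule_format, of 0] by (simp_all add: poly_rel_def)
  have "coeff p' 0 \<noteq> 0" using p0(1) partial_hom_zero_unique[OF R, of 1] by auto
  have d: "d > 0"
  proof (rule ccontr)
    assume "\<not> d > 0"
    then obtain c where "p = [:c:]" unfolding d_def by (auto elim: degree_eq_zeroE)
    then have "p = 0" using p(2) by simp
    then show False
      using p(1)[unfolded poly_rel_def, rule_format, of 0] partial_hom_zero_unique[OF R, of 1] by simp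
  qed
  \<comment> \<open>The reversed relation is shifted to degree exactly \<open>d\<close>; its leading
    coefficient is \<open>coeff p' 0\<close>, of residue 1.\<close>
  define r where "r = monom 1 (d - e) * reflect_poly p'"
  have deg_r: "degree r \<le> d" and coeff_r: "coeff r d = coeff p' 0"
  proof -
    have "degree r = d"
      unfolding r_def using \<open>coeff p' 0 \<noteq> 0\<close> deg
      by (subst degree_mult_eq) (auto simp: degree_monom_eq d_def e_def)
    then show "degree r \<le> d" by simp
    show "coeff r d = coeff p' 0"
      unfolding r_def using deg by (simp add: coeff_monom_mult coeff_reflect_poly d_def e_def)
  qed
  have r_in: "\<exists>a. (coeff r i, a) \<in> R" for i
  proof -
    have "\<exists>a. (coeff (reflect_poly p') j, a) \<in> R" for j
      using p'(1) partial_hom_zero[OF R] by (auto simp: coeff_reflect_poly poly_rel_def)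
    then show ?thesis using partial_hom_zero[OF R] by (auto simp: r_def coeff_monom_mult)
  qed
  have r_x: "poly r x = 0"
    using p'(2) x by (simp add: r_def poly_reflect_poly_nz)
  define c where "c = coeff p d * inverse (coeff p' 0)"
  have "(c, coeff 1 d * inverse 1) \<in> R"
    unfolding c_def using p0 inv[OF p0(1)] by (intro partial_hom_mult[OF R]) auto
  \<comment> \<open>Since \<open>d > 0\<close>, the top coefficient of \<open>p\<close> has residue
    0. Subtracting \<open>smult c r\<close> therefore leaves all residues unchanged.\<close>
  then have c: "(c, 0) \<in> R" using d by simp
  define p'' where "p'' = p - smult c r"
  have "poly_rel R p'' 1"
    unfolding poly_rel_def
  proof
    fix i
    obtain a where "(coeff r i, a) \<in> R" using r_in by blast
    then have "(c * coeff r i, 0 * a) \<in> R" by (intro partial_hom_mult[OF R c])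
    then have "(coeff p i - c * coeff r i, coeff 1 i - 0 * a) \<in> R"
      using p(1) by (intro partial_hom_diff[OF R]) (auto simp: poly_rel_def)
    then show "(coeff p'' i, coeff 1 i) \<in> R" by (simp add: p''_def)
  qed
  moreover have "poly p'' x = 0" using p(2) r_x by (simp add: p''_def)
  moreover have "degree p'' < d"
  proof -
    have "degree p'' \<le> d"
      unfolding p''_def using deg_r by (intro degree_diff_le) (auto simp: d_def intro: order_trans[OF degree_smult_le])
    moreover have "coeff p'' d = 0"
      using coeff_r \<open>coeff p' 0 \<noteq> 0\<close> by (simp add: p''_def c_def)
    ultimately show ?thesis using d
      by (metis degree_0 leading_coeff_0_iff le_neq_implies_less)
  qed
  ultimately show ?thesis unfolding d_def by blast
qed

text \<open>By Zorn there is a maximal extension. Maximality forces the inverse of every element of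
  nonzero residue into the domain, and if both \<open>x\<close> and \<open>inverse x\<close> were
  missing, relations of minimal degree for them would contradict the descent.\<close>

lemma ex_place_extending:
  fixes R0 :: "('f::field \<times> 'k::alg_closed_field) set"
  assumes R0: "partial_hom R0" and surj: "\<And>a. \<exists>x. (x, a) \<in> R0"
  shows "\<exists>R. partial_hom R \<and> R0 \<subseteq> R \<and> (\<forall>x. (\<exists>a. (x, a) \<in> R) \<or> (\<exists>a. (inverse x, a) \<in> R))"
proof -
  define \<A> where "\<A> = {R. partial_hom R \<and> R0 \<subseteq> R}"
  have "\<exists>M\<in>\<A>. \<forall>X\<in>\<A>. M \<subseteq> X \<longrightarrow> X = M"
  proof (rule subset_Zorn_nonempty)
    show "\<A> \<noteq> {}" using R0 by (auto simp: \<A>_def)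
    fix \<C> assume ne: "\<C> \<noteq> {}" and ch: "subset.chain \<A> \<C>"
    have sub: "\<C> \<subseteq> \<A>" using ch by (simp add: subset.chain_def)
    have common: "\<exists>C\<in>\<C>. u \<in> C \<and> v \<in> C" if "u \<in> \<Union>\<C>" "v \<in> \<Union>\<C>" for u v
      using that ch unfolding subset_chain_def by blast
    have "partial_hom (\<Union>\<C>)"
    proof (rule partial_homI)
      show "(1, 1) \<in> \<Union>\<C>"
        using ne sub partial_hom_one unfolding \<A>_def by blast
      show "(x - y, a - b) \<in> \<Union>\<C>" if "(x, a) \<in> \<Union>\<C>" "(y, b) \<in> \<Union>\<C>" for x a y b
        using common[OF that] sub partial_hom_diff unfolding \<A>_def by blast
      show "(x * y, a * b) \<in> \<Union>\<C>" if "(x, a) \<in> \<Union>\<C>" "(y, b) \<in> \<Union>\<C>" for x a y b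
        using common[OF that] sub partial_hom_mult unfolding \<A>_def by blast
      show "a = 0" if "(0, a) \<in> \<Union>\<C>" for a
        using that sub partial_hom_zero_unique unfolding \<A>_def by blast
    qed
    moreover have "R0 \<subseteq> \<Union>\<C>" using ne sub unfolding \<A>_def by blast
    ultimately show "\<Union>\<C> \<in> \<A>" by (simp add: \<A>_def)
  qed
  then obtain R where "R \<in> \<A>" and max: "\<And>X. X \<in> \<A> \<Longrightarrow> R \<subseteq> X \<Longrightarrow> X = R" by blast
  then have R: "partial_hom R" and sub: "R0 \<subseteq> R" by (auto simp: \<A>_def)
  have surjR: "\<exists>x. (x, a) \<in> R" for a using surj sub by blast
  \<comment> \<open>By maximality, the only reason for \<open>x\<close> to be missing is that the
    ideal of residues of its relations contains 1.\<close>
  have adjoin: "\<exists>p. poly_rel R p 1 \<and> poly p x = 0" if "\<nexists>a. (x, a) \<in> R" for x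
  proof (rule ccontr)
    assume "\<not> ?thesis"
    then obtain R' \<alpha> where "partial_hom R'" "R \<subseteq> R'" "(x, \<alpha>) \<in> R'"
      using partial_hom_adjoin[OF R surjR, of x] by blast
    then show False using max[of R'] sub that unfolding \<A>_def by blast
  qed
  have inv: "(inverse b, inverse \<beta>) \<in> R" if b: "(b, \<beta>) \<in> R" "\<beta> \<noteq> 0" for b \<beta>
  proof -
    have "b \<noteq> 0" using b partial_hom_zero_unique[OF R, of \<beta>] by auto
    then obtain \<gamma> where \<gamma>: "(inverse b, \<gamma>) \<in> R"
      using adjoin[of "inverse b"] poly_rel_reverse_eval[OF R _ b(1) _ b(2)] by blast
    have "(1, \<beta> * \<gamma>) \<in> R" using partial_hom_mult[OF R b(1) \<gamma>] \<open>b \<noteq> 0\<close> by simp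
    then have "\<beta> * \<gamma> = 1" using partial_hom_unique[OF R] partial_hom_one[OF R] by blast
    then show ?thesis using \<gamma> by (simp add: inverse_unique)
  qed
  have "(\<exists>a. (x, a) \<in> R) \<or> (\<exists>a. (inverse x, a) \<in> R)" for x
  proof (rule ccontr)
    assume no: "\<not> ?thesis"
    then have x: "x \<noteq> 0" using partial_hom_zero[OF R] by auto
    define P where "P y p \<longleftrightarrow> poly_rel R p 1 \<and> poly p y = 0" for y p
    have min: "\<exists>p. P y p \<and> (\<forall>q. P y q \<longrightarrow> degree p \<le> degree q)" if "\<exists>p. P y p" for y
      using that arg_min_natI[of "P y" _ degree] arg_min_nat_le[of "P y" _ degree] by blast
    obtain p where p: "P x p" "\<And>q. P x q \<Longrightarrow> degree p \<le> degree q"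
      using min[of x] adjoin[of x] no unfolding P_def by blast
    obtain p' where p': "P (inverse x) p'" "\<And>q. P (inverse x) q \<Longrightarrow> degree p' \<le> degree q"
      using min[of "inverse x"] adjoin[of "inverse x"] no unfolding P_def by blast
    show False
    proof (cases "degree p' \<le> degree p")
      case True
      then show False
        using integral_relation_descent[OF R inv _ _ _ _ x True] p p' unfolding P_def
        by (meson not_le)
    next
      case False
      then show False
        using integral_relation_descent[OF R inv, of p' "inverse x" p] p p' x unfolding P_def
        by (metis inverse_inverse_eq inverse_nonzero_iff_nonzero nle_le not_le)
    qed
  qed
  then show ?thesis using R sub by blast
qed

subsection \<open>Specialisation of isotropic subspaces\<close>

definition row_independent :: "nat \<Rightarrow> nat \<Rightarrow> (nat \<Rightarrow> nat \<Rightarrow> 'a::field) \<Rightarrow> bool" where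
  "row_independent k n v \<longleftrightarrow>
    (\<forall>c. (\<forall>p<n. (\<Sum>a<k. c a * v a p) = 0) \<longrightarrow> (\<forall>a<k. c a = 0))"

lemma row_independentD:
  "row_independent k n v \<Longrightarrow> (\<And>p. p < n \<Longrightarrow> (\<Sum>a<k. c a * v a p) = 0) \<Longrightarrow> a < k \<Longrightarrow> c a = 0"
  unfolding row_independent_def by blast

text \<open>Divisibility in a valuation ring is total, so among finitely many coordinates, not all
  zero, one divides all the others.\<close>

lemma ex_dominating_coordinate:
  fixes R :: "('f::field \<times> 'k::field) set" and u :: "nat \<Rightarrow> 'f"
  assumes R: "partial_hom R"
    and val: "\<And>x. (\<exists>a. (x, a) \<in> R) \<or> (\<exists>a. (inverse x, a) \<in> R)"
    and "\<exists>p<n. u p \<noteq> 0"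
  shows "\<exists>p<n. u p \<noteq> 0 \<and> (\<forall>q<n. \<exists>a. (u q / u p, a) \<in> R)"
  using assms(3)
proof (induction n)
  case (Suc n)
  show ?case
  proof (cases "\<exists>p<n. u p \<noteq> 0")
    case False
    then show ?thesis
      using Suc.prems partial_hom_zero[OF R] partial_hom_one[OF R]
      by (intro exI[of _ n]) (auto simp: less_Suc_eq)
  next
    case True
    then obtain p where p: "p < n" "u p \<noteq> 0" "\<And>q. q < n \<Longrightarrow> \<exists>a. (u q / u p, a) \<in> R"
      using Suc.IH by blast
    show ?thesis
    proof (cases "\<exists>a. (u n / u p, a) \<in> R")
      case True
      then show ?thesis using p by (intro exI[of _ p]) (auto simp: less_Suc_eq)
    next
      case False
      then have "u n \<noteq> 0" using partial_hom_zero[OF R] by auto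
      obtain b where b: "(u p / u n, b) \<in> R" using val[of "u n / u p"] False by auto
      have "\<exists>a. (u q / u n, a) \<in> R" if q: "q < n" for q
      proof -
        obtain a where "(u q / u p, a) \<in> R" using p(3)[OF q] by blast
        then have "((u q / u p) * (u p / u n), a * b) \<in> R" using b by (rule partial_hom_mult[OF R])
        then show ?thesis using p(2) by auto
      qed
      then show ?thesis
        using \<open>u n \<noteq> 0\<close> partial_hom_one[OF R] by (intro exI[of _ n]) (auto simp: less_Suc_eq)
    qed
  qed
qed simp

text \<open>Gaussian elimination over the valuation ring: the last row is normalised to have entry 1
  at a dominating coordinate, that coordinate is cleared from the other rows, and the process
  recurses. \<open>Q\<close> carries along any property stable under these row operations.\<close>

lemma independent_reduction:
  fixes R :: "('f::field \<times> 'k::field) set" and v :: "nat \<Rightarrow> nat \<Rightarrow> 'f"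
  assumes R: "partial_hom R"
    and val: "\<And>x. (\<exists>a. (x, a) \<in> R) \<or> (\<exists>a. (inverse x, a) \<in> R)"
    and Q: "\<And>x y c. Q x \<Longrightarrow> Q y \<Longrightarrow> Q (\<lambda>p. x p - c * y p)"
    and v: "\<And>a. a < k \<Longrightarrow> Q (v a)" "row_independent k n v"
  shows "\<exists>w x. (\<forall>a<k. Q (w a) \<and> (\<forall>p<n. (w a p, x a p) \<in> R)) \<and> row_independent k n x"
  using Q v
proof (induction k arbitrary: v Q)
  case 0
  then show ?case by (simp add: row_independent_def)
next
  case (Suc k v Q)
  have "\<exists>p<n. v k p \<noteq> 0"
  proof (rule ccontr)
    assume "\<not> ?thesis"
    then show False
      using row_independentD[OF Suc.prems(3), of "\<lambda>a. if a = k then 1 else 0" k] by simp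
  qed
  then obtain p0 where p0: "p0 < n" "v k p0 \<noteq> 0" "\<And>q. q < n \<Longrightarrow> \<exists>a. (v k q / v k p0, a) \<in> R"
    using ex_dominating_coordinate[OF R val] by blast
  define u where "u p = v k p / v k p0" for p
  have scale: "Q (\<lambda>p. c * y p)" if "Q y" for c y
    using Suc.prems(1)[OF that that, of "1 - c"] by (simp add: algebra_simps)
  have u: "Q u" "u p0 = 1"
    using scale[OF Suc.prems(2)[of k], of "inverse (v k p0)"] p0(2)
    by (simp_all add: u_def[abs_def] divide_inverse mult.commute)
  define v' where "v' a p = v a p - v a p0 * u p" for a p
  have "row_independent k n v'"
    unfolding row_independent_def
  proof (intro allI impI)
    fix c a
    assume 0: "\<forall>p<n. (\<Sum>a<k. c a * v' a p) = 0" and a: "a < k"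
    \<comment> \<open>A relation among the cleared rows becomes one among the original rows; the
      coefficient of row \<open>k\<close> absorbs what was subtracted.\<close>
    define c' where "c' a = (if a = k then - (\<Sum>a<k. c a * v a p0) / v k p0 else c a)" for a
    have "(\<Sum>a<Suc k. c' a * v a p) = (\<Sum>a<k. c a * v' a p)" for p
    proof -
      have "(\<Sum>a<k. c' a * v a p) = (\<Sum>a<k. c a * v a p)"
        by (intro sum.cong) (auto simp: c'_def)
      moreover have "(\<Sum>a<k. c a * v' a p) = (\<Sum>a<k. c a * v a p) - (\<Sum>a<k. c a * v a p0) * u p"
        by (simp add: v'_def right_diff_distrib sum_subtractf sum_distrib_right mult.assoc)
      ultimately show ?thesis by (simp add: c'_def u_def)
    qed
    then have "c' a = 0"
      using 0 a row_independentD[OF Suc.prems(3), of c' a] by simp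
    then show "c a = 0" using a by (simp add: c'_def)
  qed
  moreover have "Q (v' a) \<and> v' a p0 = 0" if "a < k" for a
    using Suc.prems(1)[OF Suc.prems(2) u(1), of a "v a p0"] that u(2) by (simp add: v'_def[abs_def])
  \<comment> \<open>Vanishing at \<open>p0\<close> is made part of the inductive property, so the
    recursively produced rows keep a zero there.\<close>
  ultimately have "\<exists>w x. (\<forall>a<k. (Q (w a) \<and> w a p0 = 0) \<and> (\<forall>p<n. (w a p, x a p) \<in> R)) \<and>
      row_independent k n x"
    by (intro Suc.IH[of "\<lambda>x. Q x \<and> x p0 = 0" v']) (simp_all add: Suc.prems(1))
  then obtain w x where w: "\<And>a. a < k \<Longrightarrow> Q (w a)" "\<And>a. a < k \<Longrightarrow> w a p0 = 0"
      "\<And>a p. a < k \<Longrightarrow> p < n \<Longrightarrow> (w a p, x a p) \<in> R" and x: "row_independent k n x"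
    by metis
  obtain y where y: "\<And>q. q < n \<Longrightarrow> (u q, y q) \<in> R" using p0(3) unfolding u_def by metis
  have "y p0 = 1"
    using y[OF p0(1)] u(2) partial_hom_unique[OF R] partial_hom_one[OF R] by metis
  have x0: "x a p0 = 0" if "a < k" for a
    using w(3)[OF that p0(1)] w(2)[OF that] partial_hom_zero_unique[OF R] by metis
  define w' where "w' a = (if a = k then u else w a)" for a
  define x' where "x' a = (if a = k then y else x a)" for a
  have "row_independent (Suc k) n x'"
    unfolding row_independent_def
  proof (rule allI, rule impI)
    fix c
    assume 0: "\<forall>p<n. (\<Sum>a<Suc k. c a * x' a p) = 0"
    have eq: "(\<Sum>a<Suc k. c a * x' a p) = (\<Sum>a<k. c a * x a p) + c k * y p" for p
      by (simp add: x'_def)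
    \<comment> \<open>Coordinate \<open>p0\<close> sees only the new row, whose residue there is 1,
      so its coefficient is zero and the inductive independence applies.\<close>
    have "(\<Sum>a<k. c a * x a p0) = 0" by (rule sum.neutral) (simp add: x0)
    then have "c k = 0" using 0 eq[of p0] p0(1) \<open>y p0 = 1\<close> by simp
    then have "\<forall>a<k. c a = 0" using 0 eq row_independentD[OF x, of c] by simp
    then show "\<forall>a<Suc k. c a = 0" using \<open>c k = 0\<close> by (simp add: less_Suc_eq)
  qed
  moreover have "\<forall>a<Suc k. Q (w' a) \<and> (\<forall>p<n. (w' a p, x' a p) \<in> R)"
    using w y u by (auto simp: w'_def x'_def less_Suc_eq)
  ultimately show ?case by blast
qed

definition form_eval :: "nat \<Rightarrow> (nat \<Rightarrow> nat \<Rightarrow> 'a::comm_ring_1) \<Rightarrow> (nat \<Rightarrow> 'a) \<Rightarrow> (nat \<Rightarrow> 'a) \<Rightarrow> 'a" where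
  "form_eval n G x y = (\<Sum>p<n. \<Sum>q<n. x p * y q * G p q)"

definition skew_matrix :: "(nat \<Rightarrow> nat \<Rightarrow> 'a::comm_ring_1) \<Rightarrow> bool" where
  "skew_matrix G \<longleftrightarrow> (\<forall>p q. G p q = - G q p) \<and> (\<forall>p. G p p = 0)"

lemma skew_matrixD:
  assumes "skew_matrix G"
  shows "G p q = - G q p" "G p p = 0"
  using assms unfolding skew_matrix_def by blast+

lemma form_eval_diff_left:
  "form_eval n G (\<lambda>p. x p - c * y p) z = form_eval n G x z - c * form_eval n G y z"
proof -
  have "form_eval n G (\<lambda>p. x p - c * y p) z =
      (\<Sum>p<n. \<Sum>q<n. x p * z q * G p q - c * (y p * z q * G p q))"
    unfolding form_eval_def by (intro sum.cong refl) (simp add: algebra_simps)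
  then show ?thesis by (simp add: form_eval_def sum_subtractf sum_distrib_left)
qed

lemma form_eval_diff_right:
  "form_eval n G z (\<lambda>p. x p - c * y p) = form_eval n G z x - c * form_eval n G z y"
proof -
  have "form_eval n G z (\<lambda>p. x p - c * y p) =
      (\<Sum>p<n. \<Sum>q<n. z p * x q * G p q - c * (z p * y q * G p q))"
    unfolding form_eval_def by (intro sum.cong refl) (simp add: algebra_simps)
  then show ?thesis by (simp add: form_eval_def sum_subtractf sum_distrib_left)
qed

lemma form_eval_add_matrix:
  "form_eval n (\<lambda>p q. G p q + c * D p q) x y = form_eval n G x y + c * form_eval n D x y"
  by (simp add: form_eval_def distrib_left sum.distrib sum_distrib_left mult_ac)

lemma form_eval_swap:
  assumes "skew_matrix G"
  shows "form_eval n G y x = - form_eval n G x y"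
proof -
  have "form_eval n G y x = (\<Sum>q<n. \<Sum>p<n. y p * x q * G p q)"
    unfolding form_eval_def by (rule sum.swap)
  also have "\<dots> = (\<Sum>q<n. \<Sum>p<n. - (x q * y p * G q p))"
  proof (intro sum.cong refl)
    fix p q
    have "G p q = - G q p" by (rule skew_matrixD(1)[OF assms])
    then show "y p * x q * G p q = - (x q * y p * G q p)" by (simp add: mult_ac)
  qed
  also have "\<dots> = - form_eval n G x y" by (simp add: form_eval_def sum_negf)
  finally show ?thesis .
qed

text \<open>In characteristic 2 this does not follow from \<open>form_eval_swap\<close>; the
  off-diagonal terms are cancelled in pairs by induction on \<open>n\<close>.\<close>

lemma form_eval_self:
  assumes "skew_matrix G"
  shows "form_eval n G x x = 0"
proof (induction n)
  case (Suc n)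
  have "(\<Sum>q<n. x n * x q * G n q) = (\<Sum>p<n. - (x p * x n * G p n))"
  proof (intro sum.cong refl)
    fix p
    have "G n p = - G p n" by (rule skew_matrixD(1)[OF assms])
    then show "x n * x p * G n p = - (x p * x n * G p n)" by (simp add: mult_ac)
  qed
  moreover have "G n n = 0" by (rule skew_matrixD(2)[OF assms])
  ultimately show ?case
    using Suc.IH by (simp add: form_eval_def sum.distrib sum_negf)
qed (simp add: form_eval_def)

text \<open>The basis is replaced by vectors of the valuation ring whose residues stay independent
  and which are still mutually orthogonal; the place then carries the isotropy equations to the
  residues.\<close>

lemma ex_isotropic_specialisation:
  fixes R :: "('f::field \<times> 'k::field) set" and v :: "nat \<Rightarrow> nat \<Rightarrow> 'f"
  assumes R: "partial_hom R"
    and val: "\<And>x. (\<exists>a. (x, a) \<in> R) \<or> (\<exists>a. (inverse x, a) \<in> R)"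
    and HG: "\<And>i p q. (H i p q, G i p q) \<in> R"
    and iso: "\<And>i a b. i < t \<Longrightarrow> a < k \<Longrightarrow> b < k \<Longrightarrow> form_eval n (H i) (v a) (v b) = 0"
    and indep: "row_independent k n v"
  shows "\<exists>x. row_independent k n x \<and> (\<forall>i<t. \<forall>a<k. \<forall>b<k. form_eval n (G i) (x a) (x b) = 0)"
proof -
  \<comment> \<open>\<open>Q\<close> is closed under linear combinations and any two of its members are orthogonal.\<close>
  define L where "L u \<longleftrightarrow> (\<forall>i<t. \<forall>b<k. form_eval n (H i) u (v b) = 0)" for u
  define Q where "Q u \<longleftrightarrow> L u \<and> (\<forall>i<t. \<forall>w. L w \<longrightarrow> form_eval n (H i) w u = 0)" for u
  have "L (\<lambda>p. x p - c * y p)" if "L x" "L y" for x y c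
    using that by (simp add: L_def form_eval_diff_left)
  then have "Q (\<lambda>p. x p - c * y p)" if "Q x" "Q y" for x y c
    using that by (simp add: Q_def form_eval_diff_right)
  moreover have "Q (v a)" if "a < k" for a
    using that iso by (simp add: Q_def L_def)
  ultimately obtain w x where w: "\<And>a. a < k \<Longrightarrow> Q (w a)"
      "\<And>a p. a < k \<Longrightarrow> p < n \<Longrightarrow> (w a p, x a p) \<in> R" and x: "row_independent k n x"
    using independent_reduction[OF R val, of Q k v n] indep by blast
  have "form_eval n (G i) (x a) (x b) = 0" if "i < t" "a < k" "b < k" for i a b
  proof -
    have "form_eval n (H i) (w a) (w b) = 0"
      using w(1) that unfolding Q_def by blast
    moreover have "(form_eval n (H i) (w a) (w b), form_eval n (G i) (x a) (x b)) \<in> R"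
      unfolding form_eval_def
      by (intro partial_hom_sum[OF R] partial_hom_mult[OF R] HG) (use w(2) that in auto)
    ultimately show ?thesis using partial_hom_zero_unique[OF R] by simp
  qed
  then show ?thesis using x by blast
qed

subsection \<open>Deformation of an isotropic subspace\<close>

lemma sum_lessThan_add:
  fixes f :: "nat \<Rightarrow> 'a::comm_monoid_add"
  shows "(\<Sum>p<k + m. f p) = (\<Sum>p<k. f p) + (\<Sum>l<m. f (k + l))"
  by (induction m) (simp_all add: add.assoc)

definition block_matrix ::
    "nat \<Rightarrow> (nat \<Rightarrow> nat \<Rightarrow> 'a::comm_ring_1) \<Rightarrow> nat \<Rightarrow> nat \<Rightarrow> 'a" where
  "block_matrix k B p q =
    (if p < k \<and> k \<le> q then B (q - k) p else if k \<le> p \<and> q < k then - B (p - k) q else 0)"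

text \<open>Row \<open>a\<close> of a basis of the graph of \<open>A\<close>, seen as a map from \<open>U\<^sub>0\<close> to its complement.\<close>

definition graph_row :: "nat \<Rightarrow> (nat \<times> nat \<Rightarrow> 'a::comm_ring_1) \<Rightarrow> nat \<Rightarrow> nat \<Rightarrow> 'a" where
  "graph_row k A a p = (if p < k then (if p = a then 1 else 0) else A (p - k, a))"

lemma skew_block_matrix: "skew_matrix (block_matrix k B)"
  by (auto simp: skew_matrix_def block_matrix_def)

text \<open>Both diagonal blocks vanish, so there is neither a constant nor a quadratic term: for
  these forms the isotropy equations of a graph are already linear in \<open>A\<close>.\<close>

lemma form_eval_block_matrix:
  assumes "a < k" "c < k"
  shows "form_eval (k + m) (block_matrix k B) (graph_row k A a) (graph_row k A c) =
    (\<Sum>l<m. B l a * A (l, c) - B l c * A (l, a))"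
proof -
  have 1: "(\<Sum>p<k. \<Sum>q<k + m. graph_row k A a p * graph_row k A c q * block_matrix k B p q) =
      (\<Sum>p<k. if p = a then \<Sum>l<m. B l a * A (l, c) else 0)"
    by (intro sum.cong refl)
      (auto simp: sum_lessThan_add graph_row_def block_matrix_def mult.commute)
  have 2: "(\<Sum>q<k + m. graph_row k A a (k + l) * graph_row k A c q * block_matrix k B (k + l) q) =
      (\<Sum>q<k. if q = c then - (B l c * A (l, a)) else 0)" for l
  proof -
    have "(\<Sum>q<k. graph_row k A a (k + l) * graph_row k A c q * block_matrix k B (k + l) q) =
        (\<Sum>q<k. if q = c then - (B l c * A (l, a)) else 0)"
      by (intro sum.cong refl) (auto simp: graph_row_def block_matrix_def mult.commute)
    moreover have "(\<Sum>l'<m. graph_row k A a (k + l) * graph_row k A c (k + l') *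
        block_matrix k B (k + l) (k + l')) = 0"
      by (simp add: block_matrix_def)
    ultimately show ?thesis by (simp only: sum_lessThan_add add_0_right)
  qed
  show ?thesis
    unfolding form_eval_def
    by (subst sum_lessThan_add) (simp only: 1 2, use assms in \<open>simp add: sum_subtractf sum_negf\<close>)
qed

text \<open>Coefficient of the unknown \<open>A (l, d)\<close> in the linearised equation \<open>(i, a, c)\<close>.\<close>

definition graph_system :: "(nat \<Rightarrow> nat \<Rightarrow> nat \<Rightarrow> 'a::comm_ring_1) \<Rightarrow> nat \<times> nat \<times> nat \<Rightarrow> nat \<times> nat \<Rightarrow> 'a" where
  "graph_system b = (\<lambda>(i, a, c) (l, d). (if d = c then b l i a else 0) - (if d = a then b l i c else 0))"

text \<open>One equation per form and unordered pair of distinct rows; the remaining ones follow by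
  skew symmetry.\<close>

definition pair_indices :: "nat \<Rightarrow> nat \<Rightarrow> (nat \<times> nat \<times> nat) set" where
  "pair_indices t k = {z \<in> {..<t} \<times> {..<k} \<times> {..<k}. fst (snd z) < snd (snd z)}"

lemma sum_pair_indices:
  "(\<Sum>z\<in>pair_indices t k. f z) = (\<Sum>i<t. \<Sum>a<k. \<Sum>c<k. if a < c then f (i, a, c) else 0)"
  unfolding pair_indices_def
  by (subst sum.inter_filter) (simp_all add: sum.cartesian_product')

text \<open>A relation \<open>y\<close> among the rows extends to a skew family \<open>S\<close>,
  and the relation in column \<open>(l, c)\<close> says that row \<open>c\<close> of
  \<open>S\<close> pairs to zero with \<open>b l\<close>. Separation is thus exactly independence of
  the rows.\<close>

lemma graph_system_solvable:
  fixes b :: "nat \<Rightarrow> nat \<Rightarrow> nat \<Rightarrow> 'a::field"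
  assumes sep: "separating t k m b"
  shows "\<exists>x. \<forall>z\<in>pair_indices t k. (\<Sum>w\<in>{..<m} \<times> {..<k}. graph_system b z w * x w) = r z"
proof (rule linear_system_solvable)
  show "finite (pair_indices t k)" by (simp add: pair_indices_def)
  fix y :: "nat \<times> nat \<times> nat \<Rightarrow> 'a"
  assume 0: "\<And>w. w \<in> {..<m} \<times> {..<k} \<Longrightarrow> (\<Sum>z\<in>pair_indices t k. y z * graph_system b z w) = 0"
  define S where "S i a c = (if a < c then y (i, a, c) else if c < a then - y (i, c, a) else 0)"
    for i a c
  have "pairing t k (\<lambda>j. S j c) (b l) = 0" if l: "l < m" and c: "c < k" for l c
  proof -
    have inner: "(\<Sum>a<k. \<Sum>d<k. if a < d then y (i, a, d) * graph_system b (i, a, d) (l, c) else 0) =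
        - (\<Sum>a<k. S i c a * b l i a)" for i
    proof -
      have "(\<Sum>a<k. \<Sum>d<k. if a < d then y (i, a, d) * graph_system b (i, a, d) (l, c) else 0) =
          (\<Sum>a<k. \<Sum>d<k. if d = c then (if a < c then y (i, a, c) * b l i a else 0) else 0) -
          (\<Sum>a<k. \<Sum>d<k. if a = c then (if c < d then y (i, c, d) * b l i d else 0) else 0)"
        unfolding sum_subtractf[symmetric]
        by (intro sum.cong refl) (auto simp: graph_system_def algebra_simps)
      also have "(\<Sum>a<k. \<Sum>d<k. if a = c then (if c < d then y (i, c, d) * b l i d else 0) else 0) =
          (\<Sum>d<k. if c < d then y (i, c, d) * b l i d else 0)"
        by (subst sum.swap) (use c in simp)
      also have "(\<Sum>a<k. \<Sum>d<k. if d = c then (if a < c then y (i, a, c) * b l i a else 0) else 0) =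
          (\<Sum>a<k. if a < c then y (i, a, c) * b l i a else 0)"
        using c by simp
      finally show ?thesis
        unfolding sum_subtractf[symmetric] sum_negf[symmetric]
        by (simp only:) (intro sum.cong refl, auto simp: S_def)
    qed
    have "0 = (\<Sum>z\<in>pair_indices t k. y z * graph_system b z (l, c))" using 0 l c by simp
    also have "\<dots> = - pairing t k (\<lambda>j. S j c) (b l)"
      unfolding sum_pair_indices inner by (simp add: pairing_def sum_negf)
    finally show ?thesis by simp
  qed
  moreover have "skew_family S" by (simp add: skew_family_def S_def)
  ultimately have "S i a c = 0" if "i < t" "a < k" "c < k" for i a c
    using sep[unfolded separating_def, rule_format, of S] that by blast
  then show "\<forall>z\<in>pair_indices t k. y z = 0"
    by (force simp: pair_indices_def S_def)
qed simp

lemma fps_nth_mult_cong: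
  assumes "\<And>n. n \<le> N \<Longrightarrow> fps_nth f n = fps_nth f' n" "\<And>n. n \<le> N \<Longrightarrow> fps_nth g n = fps_nth g' n"
    "n \<le> N"
  shows "fps_nth (f * g) n = fps_nth (f' * g') n"
  unfolding fps_mult_nth by (intro sum.cong refl arg_cong2[of _ _ _ _ "(*)"] assms) (use assms in auto)

text \<open>The block part of the pencil contributes the linear system and the part with
  \<open>D\<close> only a multiple of \<open>fps_X\<close>, quadratic in \<open>A\<close> but
  causal. So the perturbation lemma applies.\<close>

lemma ex_isotropic_fps_graph:
  fixes b :: "nat \<Rightarrow> nat \<Rightarrow> nat \<Rightarrow> 'a::field" and D :: "nat \<Rightarrow> nat \<Rightarrow> nat \<Rightarrow> 'a"
  assumes sep: "separating t k m b" and D: "\<And>i. skew_matrix (D i)"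
  shows "\<exists>A. \<forall>i<t. \<forall>a<k. \<forall>c<k. form_eval (k + m)
    (\<lambda>p q. fps_const (block_matrix k (\<lambda>l. b l i) p q) + fps_X * fps_const (D i p q))
    (graph_row k A a) (graph_row k A c) = 0"
proof -
  define H where "H i p q = fps_const (block_matrix k (\<lambda>l. b l i) p q) + fps_X * fps_const (D i p q)"
    for i p q
  define F where "F A = (\<lambda>(i, a, c). - form_eval (k + m) (\<lambda>p q. fps_const (D i p q))
      (graph_row k A a) (graph_row k A c))" for A
  have "\<exists>A. \<forall>z\<in>pair_indices t k.
      (\<Sum>w\<in>{..<m} \<times> {..<k}. fps_const (graph_system b z w) * A w) = fps_X * F A z"
  proof (rule fps_perturbation_solvable)
    show "\<exists>x. \<forall>z\<in>pair_indices t k. (\<Sum>w\<in>{..<m} \<times> {..<k}. graph_system b z w * x w) = r z" for r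
      by (rule graph_system_solvable[OF sep])
    fix A A' :: "nat \<times> nat \<Rightarrow> 'a fps" and N z
    assume "\<And>j n. n \<le> N \<Longrightarrow> fps_nth (A j) n = fps_nth (A' j) n"
    then have "fps_nth (graph_row k A a p) n = fps_nth (graph_row k A' a p) n" if "n \<le> N" for a p n
      using that by (simp add: graph_row_def)
    then have "fps_nth (graph_row k A a p * graph_row k A c q) N =
        fps_nth (graph_row k A' a p * graph_row k A' c q) N" for a c p q
      by (intro fps_nth_mult_cong[of N]) auto
    then show "fps_nth (F A z) N = fps_nth (F A' z) N"
      by (cases z) (simp add: F_def form_eval_def fps_sum_nth)
  qed
  then obtain A where A: "\<And>z. z \<in> pair_indices t k \<Longrightarrow>
      (\<Sum>w\<in>{..<m} \<times> {..<k}. fps_const (graph_system b z w) * A w) = fps_X * F A z"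
    by blast
  have lt: "form_eval (k + m) (H i) (graph_row k A a) (graph_row k A c) = 0"
    if "i < t" "a < c" "c < k" for i a c
  proof -
    have const: "(\<lambda>p q. fps_const (block_matrix k B p q)) = block_matrix k (\<lambda>l p. fps_const (B l p))"
      for B :: "nat \<Rightarrow> nat \<Rightarrow> 'a"
      by (auto simp: block_matrix_def fun_eq_iff)
    have "form_eval (k + m) (\<lambda>p q. fps_const (block_matrix k (\<lambda>l. b l i) p q))
        (graph_row k A a) (graph_row k A c) =
        (\<Sum>l<m. fps_const (b l i a) * A (l, c) - fps_const (b l i c) * A (l, a))"
      unfolding const using that by (intro form_eval_block_matrix) auto
    also have "\<dots> = (\<Sum>w\<in>{..<m} \<times> {..<k}. fps_const (graph_system b (i, a, c) w) * A w)"
    proof -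
      have "(\<Sum>d<k. fps_const (graph_system b (i, a, c) (l, d)) * A (l, d)) =
          (\<Sum>d<k. if d = c then fps_const (b l i a) * A (l, c) else 0) -
          (\<Sum>d<k. if d = a then fps_const (b l i c) * A (l, a) else 0)" for l
        unfolding sum_subtractf[symmetric]
        by (intro sum.cong refl)
          (use that in \<open>auto simp: graph_system_def simp del: fps_const_neg simp flip: fps_const_neg\<close>)
      then show ?thesis
        using that by (simp add: sum.cartesian_product')
    qed
    also have "\<dots> = fps_X * F A (i, a, c)"
      by (rule A) (use that in \<open>auto simp: pair_indices_def\<close>)
    finally show ?thesis
      unfolding H_def form_eval_add_matrix by (simp add: F_def)
  qed
  have skew: "skew_matrix (H i)" for i
  proof -
    have "H i p q = - H i q p" for p q
    proof -
      have "block_matrix k (\<lambda>l. b l i) p q = - block_matrix k (\<lambda>l. b l i) q p" "D i p q = - D i q p"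
        by (rule skew_matrixD(1)[OF skew_block_matrix]) (rule skew_matrixD(1)[OF D])
      then have "H i p q = fps_const (- block_matrix k (\<lambda>l. b l i) q p) + fps_X * fps_const (- D i q p)"
        unfolding H_def by (simp only:)
      then show ?thesis
        by (simp add: H_def fps_const_neg[symmetric] del: fps_const_neg)
    qed
    moreover have "H i p p = 0" for p
      by (simp add: H_def skew_matrixD(2)[OF D] skew_matrixD(2)[OF skew_block_matrix])
    ultimately show ?thesis unfolding skew_matrix_def by blast
  qed
  have "form_eval (k + m) (H i) (graph_row k A a) (graph_row k A c) = 0"
    if "i < t" "a < k" "c < k" for i a c
  proof (cases a c rule: linorder_cases)
    case less
    then show ?thesis using lt that by blast
  next
    case equal
    show ?thesis unfolding equal by (rule form_eval_self[OF skew])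
  next
    case greater
    then have "form_eval (k + m) (H i) (graph_row k A c) (graph_row k A a) = 0"
      using lt that by blast
    then show ?thesis
      using form_eval_swap[OF skew, of "k + m" i "graph_row k A a" "graph_row k A c"] by (simp only: minus_zero)
  qed
  then show ?thesis unfolding H_def by blast
qed

lemma fps_to_fls_sum: "fps_to_fls (sum f A) = (\<Sum>x\<in>A. fps_to_fls (f x))"
  by (induction A rule: infinite_finite_induct) auto

lemma ex_isotropic_rows:
  fixes G :: "nat \<Rightarrow> nat \<Rightarrow> nat \<Rightarrow> 'a::alg_closed_field"
  assumes t: "t \<ge> 2" and k: "k > 0" and n: "2 * n \<ge> t * (k - 1) + 2 * k"
    and G: "\<And>i. skew_matrix (G i)"
  shows "\<exists>x. row_independent k n x \<and> (\<forall>i<t. \<forall>a<k. \<forall>b<k. form_eval n (G i) (x a) (x b) = 0)"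
proof -
  have "k \<le> n" using n by simp
  then obtain m where m: "n = k + m" using le_Suc_ex by blast
  then obtain b :: "nat \<Rightarrow> nat \<Rightarrow> nat \<Rightarrow> 'a" where b: "separating t k m b"
    using ex_separating[OF t k, of m] n by auto
  define G0 where "G0 i = block_matrix k (\<lambda>l. b l i)" for i
  define D where "D i p q = G i p q - G0 i p q" for i p q
  have D: "skew_matrix (D i)" for i
  proof -
    have "D i p q = - D i q p" for p q
    proof -
      have "G i p q = - G i q p" "G0 i p q = - G0 i q p"
        unfolding G0_def by (rule skew_matrixD(1)[OF G]) (rule skew_matrixD(1)[OF skew_block_matrix])
      then show ?thesis unfolding D_def by (simp only: minus_diff_minus)
    qed
    moreover have "D i p p = 0" for p
      by (simp add: D_def G0_def skew_matrixD(2)[OF G] skew_matrixD(2)[OF skew_block_matrix])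
    ultimately show ?thesis unfolding skew_matrix_def by blast
  qed
  \<comment> \<open>The pencil as a polynomial entry: \<open>G0\<close> at 0 and \<open>G\<close> at
    1.\<close>
  define H where "H i p q = [:G0 i p q, D i p q:]" for i p q
  have H: "fps_of_poly (H i p q) = fps_const (G0 i p q) + fps_X * fps_const (D i p q)" for i p q
    by (simp add: H_def fps_of_poly_pCons mult.commute)
  have "\<exists>A. \<forall>i<t. \<forall>a<k. \<forall>c<k.
      form_eval n (\<lambda>p q. fps_of_poly (H i p q)) (graph_row k A a) (graph_row k A c) = 0"
    unfolding H G0_def m by (rule ex_isotropic_fps_graph[OF b D])
  then obtain A where A: "\<And>i a c. i < t \<Longrightarrow> a < k \<Longrightarrow> c < k \<Longrightarrow>
      form_eval n (\<lambda>p q. fps_of_poly (H i p q)) (graph_row k A a) (graph_row k A c) = 0"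
    by blast
  define v where "v a p = fps_to_fls (graph_row k A a p)" for a p
  have iso: "form_eval n (\<lambda>p q. fps_to_fls (fps_of_poly (H i p q))) (v a) (v c) = 0"
    if "i < t" "a < k" "c < k" for i a c
  proof -
    have "form_eval n (\<lambda>p q. fps_to_fls (fps_of_poly (H i p q))) (v a) (v c) =
        fps_to_fls (form_eval n (\<lambda>p q. fps_of_poly (H i p q)) (graph_row k A a) (graph_row k A c))"
      by (simp add: form_eval_def v_def fps_to_fls_sum fls_times_fps_to_fls)
    then show ?thesis using A[OF that] by simp
  qed
  have indep: "row_independent k n v"
    unfolding row_independent_def
  proof (intro allI impI)
    fix c :: "nat \<Rightarrow> 'a fls" and a
    assume 0: "\<forall>p<n. (\<Sum>a<k. c a * v a p) = 0" and a: "a < k"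
    \<comment> \<open>The first \<open>k\<close> coordinates of the graph rows form the identity
      matrix.\<close>
    have "(\<Sum>a'<k. c a' * v a' a) = (\<Sum>a'<k. if a' = a then c a else 0)"
      by (intro sum.cong refl) (use a in \<open>auto simp: v_def graph_row_def\<close>)
    also have "\<dots> = c a" using a by simp
    finally show "c a = 0" using 0 a m by simp
  qed
  \<comment> \<open>The graph of evaluation at 1 on polynomials inside the Laurent series field;
    constants make it surjective onto the base field.\<close>
  define R0 where "R0 = {(fps_to_fls (fps_of_poly p), poly p (1::'a)) | p. True}"
  have "partial_hom R0"
  proof (rule partial_homI)
    show "(1, 1) \<in> R0" unfolding R0_def by (auto intro!: exI[of _ 1])
    show "(x - y, a - b) \<in> R0" if x: "(x, a) \<in> R0" and y: "(y, b) \<in> R0" for x a y b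
    proof -
      obtain p q where "x = fps_to_fls (fps_of_poly p)" "a = poly p 1"
        "y = fps_to_fls (fps_of_poly q)" "b = poly q 1"
        using x y unfolding R0_def by blast
      then have "x - y = fps_to_fls (fps_of_poly (p - q))" "a - b = poly (p - q) 1"
        by (simp_all add: fps_of_poly_diff)
      then show ?thesis unfolding R0_def by blast
    qed
    show "(x * y, a * b) \<in> R0" if x: "(x, a) \<in> R0" and y: "(y, b) \<in> R0" for x a y b
    proof -
      obtain p q where "x = fps_to_fls (fps_of_poly p)" "a = poly p 1"
        "y = fps_to_fls (fps_of_poly q)" "b = poly q 1"
        using x y unfolding R0_def by blast
      then have "x * y = fps_to_fls (fps_of_poly (p * q))" "a * b = poly (p * q) 1"
        by (simp_all add: fps_of_poly_mult fls_times_fps_to_fls)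
      then show ?thesis unfolding R0_def by blast
    qed
    show "a = 0" if a: "(0, a) \<in> R0" for a
    proof -
      obtain p where "0 = fps_to_fls (fps_of_poly p)" "a = poly p 1"
        using a unfolding R0_def by blast
      then have "fps_of_poly p = fps_of_poly 0" by (metis fps_of_poly_0 fps_to_fls_eq_0_iff)
      then have "p = 0" by (simp only: fps_of_poly_eq_iff)
      then show ?thesis using \<open>a = poly p 1\<close> by simp
    qed
  qed
  moreover have "\<exists>x. (x, a) \<in> R0" for a
    unfolding R0_def by (auto intro!: exI[of _ "[:a:]"])
  ultimately obtain R where R: "partial_hom R" "R0 \<subseteq> R"
      and val: "\<And>x. (\<exists>a. (x, a) \<in> R) \<or> (\<exists>a. (inverse x, a) \<in> R)"
    using ex_place_extending[of R0] by blast
  have HG: "(fps_to_fls (fps_of_poly (H i p q)), G i p q) \<in> R" for i p q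
  proof -
    have "G i p q = poly (H i p q) 1" by (simp add: H_def D_def)
    then have "(fps_to_fls (fps_of_poly (H i p q)), G i p q) \<in> R0"
      unfolding R0_def by blast
    then show ?thesis using R(2) by blast
  qed
  show ?thesis by (rule ex_isotropic_specialisation[OF R(1) val HG iso indep])
qed

subsection \<open>Transfer to abstract vector spaces\<close>

context vector_space
begin

text \<open>Independence in the library concerns sets, so injectivity is needed as well for the
  \<open>k\<close> vectors to span dimension \<open>k\<close>.\<close>

lemma independent_image_if_coefficients_vanish:
  assumes zero: "\<And>c. (\<Sum>b<k. c b *s u b) = 0 \<Longrightarrow> \<forall>a<k. c a = 0"
  shows "inj_on u {..<k}" "independent (u ` {..<k::nat})"
proof -
  show inj: "inj_on u {..<k}"
  proof (rule inj_onI, rule ccontr)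
    fix a b assume ab: "a \<in> {..<k}" "b \<in> {..<k}" "u a = u b" "a \<noteq> b"
    define c where "c j = (if j = a then 1 else if j = b then - 1 else 0 :: 'a)" for j
    have "(\<Sum>j<k. c j *s u j) = (\<Sum>j\<in>{a, b}. c j *s u j)"
      by (intro sum.mono_neutral_right) (use ab in \<open>auto simp: c_def\<close>)
    also have "\<dots> = 0" using ab by (simp add: c_def)
    finally have "\<forall>j<k. c j = 0" by (rule zero)
    then have "c a = 0" using ab by blast
    then show False by (simp add: c_def)
  qed
  show "independent (u ` {..<k})"
  proof (rule independent_if_scalars_zero)
    fix f x assume 0: "(\<Sum>x\<in>u ` {..<k}. f x *s x) = 0" and x: "x \<in> u ` {..<k}"
    obtain a where a: "a < k" "x = u a" using x by auto
    have "(\<Sum>b<k. f (u b) *s u b) = 0" using 0 by (simp add: sum.reindex[OF inj])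
    then have "\<forall>b<k. f (u b) = 0" by (rule zero)
    then have "f (u a) = 0" using a(1) by blast
    then show "f x = 0" using a(2) by simp
  qed simp
qed

end

lemma bilinear_form_zero_on_span:
  assumes "vector_space scale" and \<phi>: "bilinear_form scale \<phi>"
    and 0: "\<And>x y. x \<in> X \<Longrightarrow> y \<in> X \<Longrightarrow> \<phi> x y = 0"
  shows "isotropic \<phi> (module.span scale X)"
proof -
  interpret vector_space scale by fact
  have lin: "Vector_Spaces.linear scale (*) (\<phi> u)" "Vector_Spaces.linear scale (*) (\<lambda>u. \<phi> u v)" for u v
    using \<phi> unfolding bilinear_form_def by auto
  interpret R: Vector_Spaces.linear scale "(*)" "\<phi> u" for u by (rule lin(1))
  interpret L: Vector_Spaces.linear scale "(*)" "\<lambda>u. \<phi> u v" for v by (rule lin(2))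
  have left: "\<phi> u y = 0" if "y \<in> X" "u \<in> span X" for u y
    using \<open>u \<in> span X\<close>
    by (induction rule: span_induct)
      (use 0 that in \<open>auto simp: subspace_def L.add L.scale L.zero\<close>)
  have "\<phi> u v = 0" if "u \<in> span X" "v \<in> span X" for u v
    using \<open>v \<in> span X\<close>
    by (induction rule: span_induct)
      (use left that in \<open>auto simp: subspace_def R.add R.scale R.zero\<close>)
  then show ?thesis unfolding isotropic_def by blast
qed

lemma bilinear_form_sum:
  assumes "vector_space scale" and \<phi>: "bilinear_form scale \<phi>"
  shows "\<phi> (\<Sum>p<n. scale (x p) (e p)) (\<Sum>q<n. scale (y q) (e q)) =
    form_eval n (\<lambda>p q. \<phi> (e p) (e q)) x y"
proof -
  have lin: "Vector_Spaces.linear scale (*) (\<phi> u)" "Vector_Spaces.linear scale (*) (\<lambda>u. \<phi> u v)" for u v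
    using \<phi> unfolding bilinear_form_def by auto
  interpret R: Vector_Spaces.linear scale "(*)" "\<phi> u" for u by (rule lin(1))
  interpret L: Vector_Spaces.linear scale "(*)" "\<lambda>u. \<phi> u v" for v by (rule lin(2))
  have right: "\<phi> u (\<Sum>q<n. scale (y q) (e q)) = (\<Sum>q<n. y q * \<phi> u (e q))" for u
    by (simp only: R.sum R.scale)
  have "\<phi> (\<Sum>p<n. scale (x p) (e p)) v = (\<Sum>p<n. x p * \<phi> (e p) v)" for v
    by (simp only: L.sum L.scale)
  then have "\<phi> (\<Sum>p<n. scale (x p) (e p)) (\<Sum>q<n. scale (y q) (e q)) =
      (\<Sum>p<n. x p * \<phi> (e p) (\<Sum>q<n. scale (y q) (e q)))" .
  also have "\<dots> = form_eval n (\<lambda>p q. \<phi> (e p) (e q)) x y"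
    by (simp only: right form_eval_def sum_distrib_left mult.assoc)
  finally show ?thesis .
qed

lemma skew_matrix_alternating:
  assumes "bilinear_form scale \<phi>" and alt: "alternating \<phi>"
  shows "skew_matrix (\<lambda>p q. \<phi> (e p) (e q))"
proof -
  have lin: "Vector_Spaces.linear scale (*) (\<phi> u)" "Vector_Spaces.linear scale (*) (\<lambda>u. \<phi> u v)" for u v
    using assms(1) unfolding bilinear_form_def by auto
  interpret R: Vector_Spaces.linear scale "(*)" "\<phi> u" for u by (rule lin(1))
  interpret L: Vector_Spaces.linear scale "(*)" "\<lambda>u. \<phi> u v" for v by (rule lin(2))
  have "\<phi> u v = - \<phi> v u" for u v
  proof -
    have "\<phi> (u + v) (u + v) = 0" "\<phi> u u = 0" "\<phi> v v = 0"
      using alt unfolding alternating_def by blast+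
    then show ?thesis by (simp add: L.add R.add eq_neg_iff_add_eq_0 add.commute)
  qed
  then show ?thesis using alt unfolding skew_matrix_def alternating_def by blast
qed

theorem mainTheorem2:
  fixes scale :: "'k::alg_closed_field \<Rightarrow> 'v::ab_group_add \<Rightarrow> 'v"
    and \<phi> :: "nat \<Rightarrow> 'v \<Rightarrow> 'v \<Rightarrow> 'k"
    and k t n :: nat
  assumes "vector_space scale"
    and "k > 0" and "n > 0" and "t \<ge> 2"
    and "2 * n \<ge> t * (k - 1) + 2 * k"
    and "vector_space.dim scale (UNIV :: 'v set) = n"
    and "\<And>i. i \<in> {1..t} \<Longrightarrow> bilinear_form scale (\<phi> i)"
    and "\<And>i. i \<in> {1..t} \<Longrightarrow> alternating (\<phi> i)"
  shows "\<exists>U. module.subspace scale U \<and> vector_space.dim scale U = k \<and>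
    (\<forall>i\<in>{1..t}. isotropic (\<phi> i) U)"
proof -
  interpret vector_space scale by fact
  obtain B where B: "finite B" "independent B" "card B = n"
    using finite_basis_of_dim_pos[of UNIV] assms(3,6) by auto
  obtain e where e: "bij_betw e {..<n} B"
    using ex_bij_betw_nat_finite[OF B(1)] B(3) by (auto simp: atLeast0LessThan)
  \<comment> \<open>The forms are reindexed from 0. The default 0 beyond \<open>t\<close> makes
    \<open>G i\<close> a skew matrix for every \<open>i\<close>.\<close>
  define G where "G i p q = (if i < t then \<phi> (Suc i) (e p) (e q) else 0)" for i p q
  have "skew_matrix (G i)" for i
  proof (cases "i < t")
    case True
    then show ?thesis
      unfolding G_def using skew_matrix_alternating[OF assms(7,8), of "Suc i" e] by simp
  next
    case False
    then show ?thesis by (simp add: G_def skew_matrix_def)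
  qed
  then obtain x where x: "row_independent k n x"
      "\<And>i a b. i < t \<Longrightarrow> a < k \<Longrightarrow> b < k \<Longrightarrow> form_eval n (G i) (x a) (x b) = 0"
    using ex_isotropic_rows[OF assms(4,2,5), of G] by blast
  define u where "u a = (\<Sum>p<n. scale (x a p) (e p))" for a
  have coeff: "\<forall>a<k. c a = 0" if 0: "(\<Sum>b<k. scale (c b) (u b)) = 0" for c
  proof (intro allI impI)
    fix a assume a: "a < k"
    show "c a = 0"
    proof (rule row_independentD[OF x(1) _ a])
      fix p assume p: "p < n"
      define f where "f q = (\<Sum>b<k. c b * x b q)" for q
      have "(\<Sum>b<k. scale (c b) (u b)) = (\<Sum>b<k. \<Sum>q<n. scale (c b * x b q) (e q))"
        by (simp add: u_def scale_sum_right)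
      also have "\<dots> = (\<Sum>q<n. scale (f q) (e q))"
        by (subst sum.swap) (simp add: f_def scale_sum_left)
      \<comment> \<open>The indexed sum is rewritten over the basis as a set, the shape in which its
        independence can be used.\<close>
      also have "\<dots> = (\<Sum>v\<in>B. scale (f (the_inv_into {..<n} e v)) v)"
        unfolding sum.reindex_bij_betw[OF e, symmetric]
        by (intro sum.cong refl) (use e in \<open>simp add: bij_betw_def the_inv_into_f_f\<close>)
      finally have "f (the_inv_into {..<n} e (e p)) = 0"
        using 0 p e independentD[OF B(2,1) subset_refl, of "\<lambda>v. f (the_inv_into {..<n} e v)" "e p"]
        by (auto simp: bij_betw_def)
      then show "(\<Sum>b<k. c b * x b p) = 0"
        using p e by (simp add: f_def bij_betw_def the_inv_into_f_f)
    qed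
  qed
  note indep = independent_image_if_coefficients_vanish[of u k, OF coeff]
  have "isotropic (\<phi> i) (span (u ` {..<k}))" if "i \<in> {1..t}" for i
  proof (rule bilinear_form_zero_on_span[OF assms(1) assms(7)[OF that]])
    fix v w assume "v \<in> u ` {..<k}" "w \<in> u ` {..<k}"
    then obtain a b where ab: "a < k" "b < k" "v = u a" "w = u b" by auto
    obtain j where j: "i = Suc j" "j < t" using \<open>i \<in> {1..t}\<close> by (cases i) auto
    have "\<phi> i (u a) (u b) = form_eval n (G j) (x a) (x b)"
      unfolding u_def bilinear_form_sum[OF assms(1) assms(7)[OF that]] using j by (simp add: G_def[abs_def])
    then show "\<phi> i v w = 0" using x(2)[OF j(2) ab(1,2)] ab by simp
  qed
  moreover have "dim (span (u ` {..<k})) = k"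
    using indep dim_eq_card_independent[of "u ` {..<k}"] by (simp add: card_image)
  ultimately show ?thesis using subspace_span by blast
qed

end
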